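(* Let $J=\{\nu_1,\ldots,\nu_r\}\subset\sigma(\mathcal B)$ ($r\ge1$) be a finite set of distinct Dirichlet eigenvalues and define $$P_J(s):=\prod_{k=1}^r(s-\nu_k)^2 .$$ Then $P_J$ is a real polynomial with positive leading coefficient, $$\min_{\lambda\in\sigma(\mathcal B)}P_J(\lambda)=0,$$ and its globally minimizing spectral subspace, $\ker P_J(\mathcal B)$, is exactly $$\mathcal H_J:=\bigoplus_{k=1}^r\ker(\mathcal B-\nu_kI).$$ Let $\mathsf E_J$ denote the orthogonal projection of $H$ onto $\mathcal H_J$, let $u_0\in\mathcal M$ satisfy $\mathsf E_Ju_0\ne0$, and let $u$ be the solution of $\partial_tu=-\Pi_uP_J(\mathcal B)u$, $u(0)=u_0$. Then $$u(t)\longrightarrow\frac{\mathsf E_Ju_0}{\|\mathsf E_Ju_0\|_H}\quad\text{in }H\text{ as }t\to\infty .$$ If $u_0$ has an active component outside $\mathcal H_J$ (i.e. $(I-\mathsf E_J)u_0\ne0$), the convergence is exponential: there exist $C,\delta>0$ such that $\|u(t)-\mathsf E_Ju_0/\|\mathsf E_Ju_0\|_H\|_H\le Ce^{-\delta t}$ for all $t\ge0$.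
   Context: Let $d\ge1$, let $\Omega\subset\mathbb R^d$ be a bounded connected domain with $C^\infty$ boundary, and let $H=L^2(\Omega)$ (real) with its usual inner product $\langle\cdot,\cdot\rangle_H$ and norm $\|\cdot\|_H$. Let $\mathcal B=-\Delta_D$ be the positive Dirichlet Laplacian, $\mathcal D(\mathcal B)=H^2(\Omega)\cap H^1_0(\Omega)$, with spectrum $\sigma(\mathcal B)$ consisting of eigenvalues $0<\lambda_1\le\lambda_2\le\cdots$, $\lambda_j\to\infty$ (repeated according to multiplicity) and orthonormal basis $\{e_j\}_{j\ge1}$ of $H$ with $\mathcal Be_j=\lambda_je_j$. For a real polynomial $P$ of degree $\ge1$ with positive leading coefficient and $u=\sum_ju_je_j$, $u_j=\langle u,e_j\rangle_H$, set $P(\mathcal B)u=\sum_jP(\lambda_j)u_je_j$ on $\mathcal D(P(\mathcal B))=\{u\in H:\sum_j|P(\lambda_j)|^2|u_j|^2<\infty\}$ (graph norm), and $e^{-tP(\mathcal B)}u=\sum_je^{-tP(\lambda_j)}u_je_j$. Let $\mathcal M=\{u\in H:\|u\|_H=1\}$ and $\Pi_uv=v-\langle v,u\rangle_Hu$ for $u\in\mathcal M$, $v\in H$. The solution of $\partial_tu=-\Pi_uP(\mathcal B)u$ ($t>0$), $u(0)=u_0\in\mathcal M$, is the unique $\mathcal M$-valued solution in $C([0,\infty);H)\cap C((0,\infty);\mathcal D(P(\mathcal B)))\cap C^1((0,\infty);H)$, namely $u(t)=e^{-tP(\mathcal B)}u_0/\|e^{-tP(\mathcal B)}u_0\|_H$.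 *)

theory Defs
  imports "HOL-Analysis.Analysis" "HOL-Computational_Algebra.Polynomial"
begin

text \<open>
  \<open>C_diff k f\<close>: \<open>f\<close> is of class \<open>C\<close> to the \<open>k\<close> on the whole space. Besides the partial derivatives
  being of class \<open>k - 1\<close>, total differentiability is demanded; for continuous partial derivatives
  this is automatic.
\<close>

fun C_diff :: "nat \<Rightarrow> ('a::euclidean_space \<Rightarrow> real) \<Rightarrow> bool" where
  "C_diff 0 f \<longleftrightarrow> continuous_on UNIV f"
| "C_diff (Suc k) f \<longleftrightarrow>
     (\<forall>x. f differentiable (at x)) \<and>
     (\<forall>i\<in>Basis. C_diff k (\<lambda>x. frechet_derivative f (at x) i))"

definition smooth_fun :: "('a::euclidean_space \<Rightarrow> real) \<Rightarrow> bool" where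
  "smooth_fun f \<longleftrightarrow> (\<forall>k. C_diff k f)"

text \<open>
  Smooth boundary: near each boundary point, \<open>\<Omega>\<close> is the part of a ball lying strictly above the
  graph of a smooth function over the hyperplane orthogonal to some unit vector \<open>n\<close> (the ``vertical''
  direction). The argument \<open>x - (x \<bullet> n) *\<^sub>R n\<close> is the projection of \<open>x\<close> to that hyperplane, so only the
  restriction of \<open>\<gamma>\<close> to the hyperplane matters.
\<close>

definition smooth_boundary :: "'a::euclidean_space set \<Rightarrow> bool" where
  "smooth_boundary \<Omega> \<longleftrightarrow>
     (\<forall>p\<in>frontier \<Omega>. \<exists>r>0. \<exists>n \<gamma>. norm n = 1 \<and> smooth_fun \<gamma> \<and>
        \<Omega> \<inter> ball p r = {x \<in> ball p r. \<gamma> (x - (x \<bullet> n) *\<^sub>R n) < x \<bullet> n})"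

definition smooth_bounded_domain :: "'a::euclidean_space set \<Rightarrow> bool" where
  "smooth_bounded_domain \<Omega> \<longleftrightarrow>
     open \<Omega> \<and> connected \<Omega> \<and> bounded \<Omega> \<and> \<Omega> \<noteq> {} \<and> smooth_boundary \<Omega>"

text \<open>
  Elements are represented by functions; equality in the Hilbert space is \<open>L2_eq\<close>, equality almost
  everywhere on \<open>\<Omega>\<close>. All subspaces defined below are closed under \<open>L2_eq\<close>.
\<close>

definition L2_space :: "'a::euclidean_space set \<Rightarrow> ('a \<Rightarrow> real) set" where
  "L2_space \<Omega> = {u \<in> borel_measurable (lebesgue_on \<Omega>). integrable (lebesgue_on \<Omega>) (\<lambda>x. (u x)\<^sup>2)}"

definition L2_eq :: "'a::euclidean_space set \<Rightarrow> ('a \<Rightarrow> real) \<Rightarrow> ('a \<Rightarrow> real) \<Rightarrow> bool" where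
  "L2_eq \<Omega> u v \<longleftrightarrow> (AE x in lebesgue_on \<Omega>. u x = v x)"

definition L2_inner :: "'a::euclidean_space set \<Rightarrow> ('a \<Rightarrow> real) \<Rightarrow> ('a \<Rightarrow> real) \<Rightarrow> real" where
  "L2_inner \<Omega> u v = (LINT x|lebesgue_on \<Omega>. u x * v x)"

definition L2_norm :: "'a::euclidean_space set \<Rightarrow> ('a \<Rightarrow> real) \<Rightarrow> real" where
  "L2_norm \<Omega> u = sqrt (L2_inner \<Omega> u u)"

text \<open>
  Membership is part of norm convergence, because the integral of a non-integrable function is 0 in
  the library.
\<close>

definition L2_tendsto ::
  "'a::euclidean_space set \<Rightarrow> ('b \<Rightarrow> 'a \<Rightarrow> real) \<Rightarrow> ('a \<Rightarrow> real) \<Rightarrow> 'b filter \<Rightarrow> bool" where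
  "L2_tendsto \<Omega> f g F \<longleftrightarrow>
     g \<in> L2_space \<Omega> \<and> (\<forall>\<^sub>F s in F. f s \<in> L2_space \<Omega>) \<and>
     ((\<lambda>s. L2_norm \<Omega> (\<lambda>x. f s x - g x)) \<longlongrightarrow> 0) F"

text \<open>A representative of the norm limit of the series.\<close>

definition L2_suminf ::
  "'a::euclidean_space set \<Rightarrow> (nat \<Rightarrow> 'a \<Rightarrow> real) \<Rightarrow> 'a \<Rightarrow> real" where
  "L2_suminf \<Omega> f = (SOME v. L2_tendsto \<Omega> (\<lambda>n x. \<Sum>j<n. f j x) v sequentially)"

text \<open>A representative of the orthogonal projection of \<open>u\<close> to the subspace \<open>V\<close>.\<close>

definition L2_proj ::
  "'a::euclidean_space set \<Rightarrow> ('a \<Rightarrow> real) set \<Rightarrow> ('a \<Rightarrow> real) \<Rightarrow> 'a \<Rightarrow> real" where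
  "L2_proj \<Omega> V u = (SOME w. w \<in> V \<and> (\<forall>v\<in>V. L2_inner \<Omega> (\<lambda>x. u x - w x) v = 0))"

definition op_kernel ::
  "'a::euclidean_space set \<Rightarrow> ('a \<Rightarrow> real) set \<Rightarrow> (('a \<Rightarrow> real) \<Rightarrow> 'a \<Rightarrow> real) \<Rightarrow> ('a \<Rightarrow> real) set" where
  "op_kernel \<Omega> D A = {u \<in> D. L2_eq \<Omega> (A u) (\<lambda>x. 0)}"

definition op_shift ::
  "(('a \<Rightarrow> real) \<Rightarrow> 'a \<Rightarrow> real) \<Rightarrow> real \<Rightarrow> ('a \<Rightarrow> real) \<Rightarrow> 'a \<Rightarrow> real" where
  "op_shift A \<mu> = (\<lambda>u x. A u x - \<mu> * u x)"

text \<open>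
  An unbounded operator is given by a domain \<open>D\<close> and an action \<open>A\<close> on representatives. Resolvent set: \<open>A - \<mu>\<close> maps \<open>D\<close> onto the whole space and has a bounded inverse (the lower
  bound also gives injectivity).
\<close>

definition op_resolvent_set ::
  "'a::euclidean_space set \<Rightarrow> ('a \<Rightarrow> real) set \<Rightarrow> (('a \<Rightarrow> real) \<Rightarrow> 'a \<Rightarrow> real) \<Rightarrow> real set" where
  "op_resolvent_set \<Omega> D A =
     {\<mu>. (\<forall>f\<in>L2_space \<Omega>. \<exists>u\<in>D. L2_eq \<Omega> (op_shift A \<mu> u) f) \<and>
         (\<exists>C. \<forall>u\<in>D. L2_norm \<Omega> u \<le> C * L2_norm \<Omega> (op_shift A \<mu> u))}"

definition op_spectrum ::
  "'a::euclidean_space set \<Rightarrow> ('a \<Rightarrow> real) set \<Rightarrow> (('a \<Rightarrow> real) \<Rightarrow> 'a \<Rightarrow> real) \<Rightarrow> real set" where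
  "op_spectrum \<Omega> D A = - op_resolvent_set \<Omega> D A"

definition test_fun :: "'a::euclidean_space set \<Rightarrow> ('a \<Rightarrow> real) \<Rightarrow> bool" where
  "test_fun \<Omega> \<phi> \<longleftrightarrow>
     smooth_fun \<phi> \<and> compact (closure {x. \<phi> x \<noteq> 0}) \<and> closure {x. \<phi> x \<noteq> 0} \<subseteq> \<Omega>"

definition has_weak_deriv ::
  "'a::euclidean_space set \<Rightarrow> 'a \<Rightarrow> ('a \<Rightarrow> real) \<Rightarrow> ('a \<Rightarrow> real) \<Rightarrow> bool" where
  "has_weak_deriv \<Omega> i u g \<longleftrightarrow>
     g \<in> L2_space \<Omega> \<and>
     (\<forall>\<phi>. test_fun \<Omega> \<phi> \<longrightarrow>
        L2_inner \<Omega> u (\<lambda>x. frechet_derivative \<phi> (at x) i) = - L2_inner \<Omega> g \<phi>)"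

text \<open>A representative of the weak derivative, which is unique only almost everywhere.\<close>

definition weak_deriv ::
  "'a::euclidean_space set \<Rightarrow> 'a \<Rightarrow> ('a \<Rightarrow> real) \<Rightarrow> 'a \<Rightarrow> real" where
  "weak_deriv \<Omega> i u = (SOME g. has_weak_deriv \<Omega> i u g)"

definition H1_space :: "'a::euclidean_space set \<Rightarrow> ('a \<Rightarrow> real) set" where
  "H1_space \<Omega> = {u \<in> L2_space \<Omega>. \<forall>i\<in>Basis. \<exists>g. has_weak_deriv \<Omega> i u g}"

definition H2_space :: "'a::euclidean_space set \<Rightarrow> ('a \<Rightarrow> real) set" where
  "H2_space \<Omega> = {u \<in> H1_space \<Omega>. \<forall>i\<in>Basis. weak_deriv \<Omega> i u \<in> H1_space \<Omega>}"

definition H1_norm :: "'a::euclidean_space set \<Rightarrow> ('a \<Rightarrow> real) \<Rightarrow> real" where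
  "H1_norm \<Omega> u = sqrt ((L2_norm \<Omega> u)\<^sup>2 + (\<Sum>i\<in>Basis. (L2_norm \<Omega> (weak_deriv \<Omega> i u))\<^sup>2))"

definition H10_space :: "'a::euclidean_space set \<Rightarrow> ('a \<Rightarrow> real) set" where
  "H10_space \<Omega> = {u \<in> H1_space \<Omega>.
     \<forall>\<epsilon>>0. \<exists>\<phi>. test_fun \<Omega> \<phi> \<and> H1_norm \<Omega> (\<lambda>x. u x - \<phi> x) < \<epsilon>}"

definition dirichlet_dom :: "'a::euclidean_space set \<Rightarrow> ('a \<Rightarrow> real) set" where
  "dirichlet_dom \<Omega> = H2_space \<Omega> \<inter> H10_space \<Omega>"

definition dirichlet_op ::
  "'a::euclidean_space set \<Rightarrow> ('a \<Rightarrow> real) \<Rightarrow> 'a \<Rightarrow> real" where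
  "dirichlet_op \<Omega> u = (\<lambda>x. - (\<Sum>i\<in>Basis. weak_deriv \<Omega> i (weak_deriv \<Omega> i u) x))"

definition dirichlet_spectrum :: "'a::euclidean_space set \<Rightarrow> real set" where
  "dirichlet_spectrum \<Omega> = op_spectrum \<Omega> (dirichlet_dom \<Omega>) (dirichlet_op \<Omega>)"

definition dirichlet_eigenspace :: "'a::euclidean_space set \<Rightarrow> real \<Rightarrow> ('a \<Rightarrow> real) set" where
  "dirichlet_eigenspace \<Omega> \<nu> = op_kernel \<Omega> (dirichlet_dom \<Omega>) (op_shift (dirichlet_op \<Omega>) \<nu>)"

text \<open>
  An orthonormal basis of eigenfunctions with eigenvalues in increasing order, repeated according to
  multiplicity; indices start at 0.
\<close>

definition dirichlet_eigenbasis ::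
  "'a::euclidean_space set \<Rightarrow> (nat \<Rightarrow> real) \<Rightarrow> (nat \<Rightarrow> 'a \<Rightarrow> real) \<Rightarrow> bool" where
  "dirichlet_eigenbasis \<Omega> lam e \<longleftrightarrow>
     0 < lam 0 \<and> mono lam \<and> filterlim lam at_top sequentially \<and>
     (\<forall>j. e j \<in> dirichlet_dom \<Omega> \<and> L2_eq \<Omega> (dirichlet_op \<Omega> (e j)) (\<lambda>x. lam j * e j x)) \<and>
     (\<forall>j k. L2_inner \<Omega> (e j) (e k) = (if j = k then 1 else 0)) \<and>
     (\<forall>u\<in>L2_space \<Omega>.
        L2_tendsto \<Omega> (\<lambda>n x. \<Sum>j<n. L2_inner \<Omega> u (e j) * e j x) u sequentially)"

definition poly_dom ::
  "'a::euclidean_space set \<Rightarrow> (nat \<Rightarrow> real) \<Rightarrow> (nat \<Rightarrow> 'a \<Rightarrow> real) \<Rightarrow> real poly \<Rightarrow> ('a \<Rightarrow> real) set" where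
  "poly_dom \<Omega> lam e P =
     {u \<in> L2_space \<Omega>. summable (\<lambda>j. \<bar>poly P (lam j)\<bar>\<^sup>2 * \<bar>L2_inner \<Omega> u (e j)\<bar>\<^sup>2)}"

definition poly_op ::
  "'a::euclidean_space set \<Rightarrow> (nat \<Rightarrow> real) \<Rightarrow> (nat \<Rightarrow> 'a \<Rightarrow> real) \<Rightarrow> real poly \<Rightarrow>
     ('a \<Rightarrow> real) \<Rightarrow> 'a \<Rightarrow> real" where
  "poly_op \<Omega> lam e P u = L2_suminf \<Omega> (\<lambda>j x. poly P (lam j) * L2_inner \<Omega> u (e j) * e j x)"

text \<open>
  The kernel of \<open>P(B) - m\<close>, where \<open>m\<close> is the minimum of \<open>P\<close> on the spectrum of \<open>B\<close>.
\<close>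

definition minimizing_subspace ::
  "'a::euclidean_space set \<Rightarrow> (nat \<Rightarrow> real) \<Rightarrow> (nat \<Rightarrow> 'a \<Rightarrow> real) \<Rightarrow> real poly \<Rightarrow> ('a \<Rightarrow> real) set" where
  "minimizing_subspace \<Omega> lam e P =
     op_kernel \<Omega> (poly_dom \<Omega> lam e P)
       (op_shift (poly_op \<Omega> lam e P) (INF \<mu>\<in>dirichlet_spectrum \<Omega>. poly P \<mu>))"

definition L2_sphere :: "'a::euclidean_space set \<Rightarrow> ('a \<Rightarrow> real) set" where
  "L2_sphere \<Omega> = {u \<in> L2_space \<Omega>. L2_norm \<Omega> u = 1}"

definition tangent_proj ::
  "'a::euclidean_space set \<Rightarrow> ('a \<Rightarrow> real) \<Rightarrow> ('a \<Rightarrow> real) \<Rightarrow> 'a \<Rightarrow> real" where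
  "tangent_proj \<Omega> u v = (\<lambda>x. v x - L2_inner \<Omega> v u * u x)"

text \<open>
  Solutions with values in the unit sphere: continuous in norm on \<open>[0,\<infinity>)\<close>, continuous into the domain
  of \<open>P(B)\<close> with its graph norm on \<open>(0,\<infinity>)\<close>, and continuously differentiable in norm on \<open>(0,\<infinity>)\<close>.
\<close>

definition flow_solution ::
  "'a::euclidean_space set \<Rightarrow> (nat \<Rightarrow> real) \<Rightarrow> (nat \<Rightarrow> 'a \<Rightarrow> real) \<Rightarrow> real poly \<Rightarrow>
     ('a \<Rightarrow> real) \<Rightarrow> (real \<Rightarrow> 'a \<Rightarrow> real) \<Rightarrow> bool" where
  "flow_solution \<Omega> lam e P u0 u \<longleftrightarrow>
     L2_eq \<Omega> (u 0) u0 \<and>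
     (\<forall>t\<ge>0. u t \<in> L2_sphere \<Omega> \<and> L2_tendsto \<Omega> u (u t) (at t within {0..})) \<and>
     (\<forall>t>0. u t \<in> poly_dom \<Omega> lam e P \<and>
            L2_tendsto \<Omega> (\<lambda>s. poly_op \<Omega> lam e P (u s)) (poly_op \<Omega> lam e P (u t)) (at t)) \<and>
     (\<exists>u'. \<forall>t>0.
        L2_tendsto \<Omega> (\<lambda>h x. (u (t + h) x - u t x) / h) (u' t) (at 0) \<and>
        L2_tendsto \<Omega> u' (u' t) (at t) \<and>
        L2_eq \<Omega> (u' t) (\<lambda>x. - tangent_proj \<Omega> (u t) (poly_op \<Omega> lam e P (u t)) x))"

definition P_sel :: "real set \<Rightarrow> real poly" where
  "P_sel J = (\<Prod>\<nu>\<in>J. [:- \<nu>, 1:] ^ 2)"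

text \<open>The sum of the eigenspaces for the eigenvalues in \<open>J\<close>; \<open>eigen_sum_direct\<close> says it is direct.\<close>

definition eigen_sum :: "'a::euclidean_space set \<Rightarrow> real set \<Rightarrow> ('a \<Rightarrow> real) set" where
  "eigen_sum \<Omega> J =
     {u \<in> L2_space \<Omega>. \<exists>w. (\<forall>\<nu>\<in>J. w \<nu> \<in> dirichlet_eigenspace \<Omega> \<nu>) \<and>
        L2_eq \<Omega> u (\<lambda>x. \<Sum>\<nu>\<in>J. w \<nu> x)}"

definition eigen_sum_direct :: "'a::euclidean_space set \<Rightarrow> real set \<Rightarrow> bool" where
  "eigen_sum_direct \<Omega> J \<longleftrightarrow>
     (\<forall>w. (\<forall>\<nu>\<in>J. w \<nu> \<in> dirichlet_eigenspace \<Omega> \<nu>) \<and>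
          L2_eq \<Omega> (\<lambda>x. \<Sum>\<nu>\<in>J. w \<nu> x) (\<lambda>x. 0) \<longrightarrow>
        (\<forall>\<nu>\<in>J. L2_eq \<Omega> (w \<nu>) (\<lambda>x. 0)))"

end

theory Submission
  imports Defs
begin

text \<open>
  Everything is diagonal in the eigenbasis: \<open>P(B)\<close> multiplies the \<open>j\<close>-th coordinate by \<open>P(\<lambda>\<^sub>j)\<close>, and
  \<open>P = P\<^sub>J\<close> is nonnegative with zero set exactly \<open>J\<close>. Hence the minimum over the spectrum is \<open>0\<close>, and
  the kernel of \<open>P(B)\<close> consists of the \<open>u\<close> whose coordinates vanish for \<open>\<lambda>\<^sub>j \<notin> J\<close>
  (\<open>op_kernel_poly_op_iff\<close>). The sum of the eigenspaces has the same description (\<open>eigen_sum_iff\<close>),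
  because eigenspaces for different eigenvalues are orthogonal and because finite combinations of
  eigenfunctions for one eigenvalue are eigenfunctions.

  In coordinates the flow reads \<open>y\<^sub>j' = (m - P(\<lambda>\<^sub>j)) y\<^sub>j\<close> with \<open>m = \<langle>P(B) u, u\<rangle>\<close> independent of \<open>j\<close>. So
  \<open>y\<^sub>j(t) = c(t) e\<^bsup>-P(\<lambda>\<^sub>j) t\<^esup> y\<^sub>j(0)\<close> with a common factor \<open>c(t) > 0\<close> (\<open>flow_coefs\<close>): the coordinates with
  \<open>\<lambda>\<^sub>j \<in> J\<close> keep their proportions, the others decay at least like \<open>e\<^bsup>-\<delta> t\<^esup>\<close>, where \<open>\<delta> > 0\<close> is a lower
  bound of \<open>P\<close> on the eigenvalues outside \<open>J\<close> (\<open>P_sel_gap\<close>). Normalization then gives exponential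
  convergence to the direction of the projection of \<open>u\<^sub>0\<close> (\<open>flow_convergence\<close>).

  The analytic input behind this is of three kinds. Completeness of \<open>L\<^sup>2\<close> (\<open>L2_complete\<close>) makes the
  series defining \<open>P(B) u\<close> converge. Density of test functions (\<open>zero_AE_if_orthogonal_test_fun\<close>)
  makes weak derivatives unique, hence the Laplacian linear up to null sets. Integration by parts for
  test functions (\<open>test_fun_integral_by_parts\<close>), extended to \<open>H\<^sup>1\<^sub>0\<close> by approximation
  (\<open>H10_integral_by_parts\<close>), makes the Laplacian symmetric on \<open>H\<^sup>2 \<inter> H\<^sup>1\<^sub>0\<close>, whence the orthogonality of
  its eigenspaces.
\<close>

section \<open>The space of square integrable functions\<close>

lemma L2_measurable: "u \<in> L2_space \<Omega> \<Longrightarrow> u \<in> borel_measurable (lebesgue_on \<Omega>)"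
  by (simp add: L2_space_def)

lemma L2_mult_integrable:
  assumes "u \<in> L2_space \<Omega>" "v \<in> L2_space \<Omega>"
  shows "integrable (lebesgue_on \<Omega>) (\<lambda>x. u x * v x)"
proof (rule Bochner_Integration.integrable_bound)
  show "integrable (lebesgue_on \<Omega>) (\<lambda>x. (u x)\<^sup>2 + (v x)\<^sup>2)"
    using assms by (auto simp: L2_space_def)
  show "(\<lambda>x. u x * v x) \<in> borel_measurable (lebesgue_on \<Omega>)"
    using assms by (auto simp: L2_space_def)
  have "\<bar>a * b\<bar> \<le> a\<^sup>2 + b\<^sup>2" for a b :: real
  proof -
    have "2 * (\<bar>a\<bar> * \<bar>b\<bar>) \<le> \<bar>a\<bar>\<^sup>2 + \<bar>b\<bar>\<^sup>2"
      using sum_squares_bound[of "\<bar>a\<bar>" "\<bar>b\<bar>"] by simp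
    moreover have "0 \<le> \<bar>a\<bar> * \<bar>b\<bar>" by simp
    ultimately have "\<bar>a\<bar> * \<bar>b\<bar> \<le> \<bar>a\<bar>\<^sup>2 + \<bar>b\<bar>\<^sup>2" by linarith
    then show ?thesis by (simp add: abs_mult)
  qed
  then show "AE x in lebesgue_on \<Omega>. norm (u x * v x) \<le> norm ((u x)\<^sup>2 + (v x)\<^sup>2)"
    by (intro AE_I2) (simp add: order_trans[OF _ abs_ge_self])
qed

lemma L2_scale:
  assumes "u \<in> L2_space \<Omega>" shows "(\<lambda>x. c * u x) \<in> L2_space \<Omega>"
  using assms by (auto simp: L2_space_def power_mult_distrib)

lemma L2_add:
  assumes "u \<in> L2_space \<Omega>" "v \<in> L2_space \<Omega>"
  shows "(\<lambda>x. u x + v x) \<in> L2_space \<Omega>"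
proof -
  have "integrable (lebesgue_on \<Omega>) (\<lambda>x. (u x)\<^sup>2 + (v x)\<^sup>2 + 2 * (u x * v x))"
    using assms L2_mult_integrable[OF assms] by (auto simp: L2_space_def)
  then have "integrable (lebesgue_on \<Omega>) (\<lambda>x. (u x + v x)\<^sup>2)"
    by (simp add: power2_sum mult.assoc)
  with assms show ?thesis by (auto simp: L2_space_def)
qed

lemma L2_zero [simp]: "(\<lambda>x. 0) \<in> L2_space \<Omega>"
  by (simp add: L2_space_def)

lemma L2_diff:
  assumes "u \<in> L2_space \<Omega>" "v \<in> L2_space \<Omega>"
  shows "(\<lambda>x. u x - v x) \<in> L2_space \<Omega>"
  using L2_add[OF assms(1) L2_scale[OF assms(2), of "-1"]] by simp

lemma L2_sum:
  assumes "\<And>i. i \<in> I \<Longrightarrow> f i \<in> L2_space \<Omega>"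
  shows "(\<lambda>x. \<Sum>i\<in>I. f i x) \<in> L2_space \<Omega>"
  using assms by (induction I rule: infinite_finite_induct) (auto intro: L2_add)

lemma L2_inner_commute: "L2_inner \<Omega> u v = L2_inner \<Omega> v u"
  by (simp add: L2_inner_def mult.commute)

lemma L2_inner_scale_left: "L2_inner \<Omega> (\<lambda>x. c * u x) v = c * L2_inner \<Omega> u v"
  by (simp add: L2_inner_def mult.assoc)

lemma L2_inner_scale_right: "L2_inner \<Omega> u (\<lambda>x. c * v x) = c * L2_inner \<Omega> u v"
  by (metis L2_inner_commute L2_inner_scale_left)

lemma L2_inner_zero_left [simp]: "L2_inner \<Omega> (\<lambda>x. 0) v = 0"
  by (simp add: L2_inner_def)

lemma L2_inner_add_left:
  assumes "u \<in> L2_space \<Omega>" "v \<in> L2_space \<Omega>" "w \<in> L2_space \<Omega>"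
  shows "L2_inner \<Omega> (\<lambda>x. u x + v x) w = L2_inner \<Omega> u w + L2_inner \<Omega> v w"
  using assms by (simp add: L2_inner_def distrib_right L2_mult_integrable)

lemma L2_inner_diff_left:
  assumes "u \<in> L2_space \<Omega>" "v \<in> L2_space \<Omega>" "w \<in> L2_space \<Omega>"
  shows "L2_inner \<Omega> (\<lambda>x. u x - v x) w = L2_inner \<Omega> u w - L2_inner \<Omega> v w"
  using assms by (simp add: L2_inner_def left_diff_distrib L2_mult_integrable)

lemma L2_inner_add_right:
  assumes "u \<in> L2_space \<Omega>" "v \<in> L2_space \<Omega>" "w \<in> L2_space \<Omega>"
  shows "L2_inner \<Omega> w (\<lambda>x. u x + v x) = L2_inner \<Omega> w u + L2_inner \<Omega> w v"
  using L2_inner_add_left[OF assms] by (simp add: L2_inner_commute)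

lemma L2_inner_diff_right:
  assumes "u \<in> L2_space \<Omega>" "v \<in> L2_space \<Omega>" "w \<in> L2_space \<Omega>"
  shows "L2_inner \<Omega> w (\<lambda>x. u x - v x) = L2_inner \<Omega> w u - L2_inner \<Omega> w v"
  using L2_inner_diff_left[OF assms] by (simp add: L2_inner_commute)

lemma L2_inner_sum_left:
  assumes "\<And>i. i \<in> I \<Longrightarrow> f i \<in> L2_space \<Omega>" "w \<in> L2_space \<Omega>"
  shows "L2_inner \<Omega> (\<lambda>x. \<Sum>i\<in>I. f i x) w = (\<Sum>i\<in>I. L2_inner \<Omega> (f i) w)"
  using assms
  by (induction I rule: infinite_finite_induct) (simp_all add: L2_inner_add_left L2_sum)

lemma L2_inner_self_nonneg: "0 \<le> L2_inner \<Omega> u u"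
  by (simp add: L2_inner_def)

lemma L2_norm_nonneg [simp]: "0 \<le> L2_norm \<Omega> u"
  by (simp add: L2_norm_def L2_inner_self_nonneg)

lemma L2_norm_square: "(L2_norm \<Omega> u)\<^sup>2 = L2_inner \<Omega> u u"
  by (simp add: L2_norm_def L2_inner_self_nonneg)

lemma L2_norm_scale: "L2_norm \<Omega> (\<lambda>x. c * u x) = \<bar>c\<bar> * L2_norm \<Omega> u"
  by (simp add: L2_norm_def L2_inner_scale_left L2_inner_scale_right real_sqrt_mult
      flip: mult.assoc)

lemma L2_norm_minus_commute: "L2_norm \<Omega> (\<lambda>x. u x - v x) = L2_norm \<Omega> (\<lambda>x. v x - u x)"
  using L2_norm_scale[of \<Omega> "-1" "\<lambda>x. u x - v x"] by simp

lemma L2_norm_diff_square: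
  assumes "u \<in> L2_space \<Omega>" "v \<in> L2_space \<Omega>"
  shows "(L2_norm \<Omega> (\<lambda>x. u x - v x))\<^sup>2 = (L2_norm \<Omega> u)\<^sup>2 - 2 * L2_inner \<Omega> u v + (L2_norm \<Omega> v)\<^sup>2"
  using assms
  by (simp add: L2_norm_square L2_inner_diff_left L2_inner_diff_right L2_diff L2_inner_commute)

lemma L2_inner_self_eq_0_iff:
  assumes "u \<in> L2_space \<Omega>"
  shows "L2_inner \<Omega> u u = 0 \<longleftrightarrow> L2_eq \<Omega> u (\<lambda>x. 0)"
  using integral_nonneg_eq_0_iff_AE[OF L2_mult_integrable[OF assms assms]]
  by (simp add: L2_inner_def L2_eq_def)

lemma L2_norm_eq_0_iff:
  assumes "u \<in> L2_space \<Omega>"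
  shows "L2_norm \<Omega> u = 0 \<longleftrightarrow> L2_eq \<Omega> u (\<lambda>x. 0)"
  by (simp add: L2_norm_def L2_inner_self_eq_0_iff[OF assms])

lemma L2_eq_sym: "L2_eq \<Omega> u v \<Longrightarrow> L2_eq \<Omega> v u"
  unfolding L2_eq_def by (erule AE_mp) simp

lemma L2_eq_trans: "L2_eq \<Omega> u v \<Longrightarrow> L2_eq \<Omega> v w \<Longrightarrow> L2_eq \<Omega> u w"
  unfolding L2_eq_def by (erule (1) AE_mp[OF AE_conjI]) simp

lemma L2_eq_diff_zero_iff: "L2_eq \<Omega> (\<lambda>x. u x - v x) (\<lambda>x. 0) \<longleftrightarrow> L2_eq \<Omega> u v"
  by (simp add: L2_eq_def)

lemma L2_inner_cong:
  assumes "L2_eq \<Omega> u v" "u \<in> L2_space \<Omega>" "v \<in> L2_space \<Omega>" "w \<in> L2_space \<Omega>"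
  shows "L2_inner \<Omega> u w = L2_inner \<Omega> v w"
  unfolding L2_inner_def
proof (rule integral_cong_AE)
  show "AE x in lebesgue_on \<Omega>. u x * w x = v x * w x"
    using assms(1) unfolding L2_eq_def by (rule AE_mp) simp
qed (use assms in \<open>auto simp: L2_space_def\<close>)

lemma L2_norm_cong:
  assumes "L2_eq \<Omega> u v" "u \<in> L2_space \<Omega>" "v \<in> L2_space \<Omega>"
  shows "L2_norm \<Omega> u = L2_norm \<Omega> v"
  using L2_inner_cong[OF assms(1-3) assms(2)] L2_inner_cong[OF assms(1-3) assms(3)]
  unfolding L2_norm_def by (metis L2_inner_commute)

text \<open>
  The form \<open>\<parallel>s u - t v\<parallel>\<^sup>2 = s\<^sup>2 a - 2 s t b + t\<^sup>2 c\<close> is nonnegative in \<open>(s, t)\<close>, so its discriminant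
  \<open>b\<^sup>2 - a c\<close> cannot be positive.
\<close>

lemma L2_Cauchy_Schwarz:
  assumes "u \<in> L2_space \<Omega>" "v \<in> L2_space \<Omega>"
  shows "\<bar>L2_inner \<Omega> u v\<bar> \<le> L2_norm \<Omega> u * L2_norm \<Omega> v"
proof -
  define a b c where "a = L2_inner \<Omega> u u" and "b = L2_inner \<Omega> u v" and "c = L2_inner \<Omega> v v"
  have nn: "0 \<le> a" "0 \<le> c" by (simp_all add: a_def c_def L2_inner_self_nonneg)
  have quad: "0 \<le> s\<^sup>2 * a - 2 * (s * t * b) + t\<^sup>2 * c" for s t
  proof -
    have "0 \<le> (L2_norm \<Omega> (\<lambda>x. s * u x - t * v x))\<^sup>2" by simp
    also have "\<dots> = s\<^sup>2 * a - 2 * (s * t * b) + t\<^sup>2 * c"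
      by (subst L2_norm_diff_square[OF L2_scale[OF assms(1)] L2_scale[OF assms(2)], of s t],
          simp only: L2_norm_square L2_inner_scale_left L2_inner_scale_right a_def b_def c_def)
        (simp add: power2_eq_square algebra_simps)
    finally show ?thesis .
  qed
  have "b\<^sup>2 \<le> a * c"
  proof (cases "a = 0")
    case True
    \<comment> \<open>The form is then linear in \<open>s\<close>, and any \<open>s > c / 2\<close> at \<open>t = b\<close> forces \<open>b = 0\<close>.\<close>
    have "0 \<le> - 2 * b * ((c + 1) * b) + b\<^sup>2 * c"
      using quad[of "c + 1" b] True by (simp add: algebra_simps)
    then have "b\<^sup>2 * (c + 2) \<le> 0" by (simp add: power2_eq_square algebra_simps)
    then have "b\<^sup>2 \<le> 0" using nn(2) by (smt (verit) mult_nonneg_nonneg mult_pos_pos zero_le_power2)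
    with True show ?thesis by simp
  next
    case False
    then have "0 < a" using nn by simp
    have "0 \<le> a * (a * c - b\<^sup>2)"
      using quad[of b a] by (simp add: power2_eq_square algebra_simps)
    with \<open>0 < a\<close> show ?thesis by (simp add: zero_le_mult_iff)
  qed
  then have "sqrt (b\<^sup>2) \<le> sqrt (a * c)" by (rule real_sqrt_le_mono)
  then show ?thesis by (simp add: L2_norm_def a_def b_def c_def real_sqrt_mult)
qed

lemma L2_norm_triangle:
  assumes "u \<in> L2_space \<Omega>" "v \<in> L2_space \<Omega>"
  shows "L2_norm \<Omega> (\<lambda>x. u x + v x) \<le> L2_norm \<Omega> u + L2_norm \<Omega> v"
proof (rule power2_le_imp_le)
  have "(L2_norm \<Omega> (\<lambda>x. u x + v x))\<^sup>2 = (L2_norm \<Omega> u)\<^sup>2 + 2 * L2_inner \<Omega> u v + (L2_norm \<Omega> v)\<^sup>2"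
    using assms
    by (simp add: L2_norm_square L2_inner_add_left L2_inner_add_right L2_add L2_inner_commute)
  also have "\<dots> \<le> (L2_norm \<Omega> u + L2_norm \<Omega> v)\<^sup>2"
    using L2_Cauchy_Schwarz[OF assms] by (simp add: power2_sum mult.assoc)
  finally show "(L2_norm \<Omega> (\<lambda>x. u x + v x))\<^sup>2 \<le> (L2_norm \<Omega> u + L2_norm \<Omega> v)\<^sup>2" .
qed simp

lemma L2_tendsto_inner:
  assumes "L2_tendsto \<Omega> f g F" "v \<in> L2_space \<Omega>"
  shows "((\<lambda>s. L2_inner \<Omega> (f s) v) \<longlongrightarrow> L2_inner \<Omega> g v) F"
proof (rule LIM_zero_cancel, rule Lim_null_comparison)
  have ev: "\<forall>\<^sub>F s in F. f s \<in> L2_space \<Omega>" and g: "g \<in> L2_space \<Omega>"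
    and lim: "((\<lambda>s. L2_norm \<Omega> (\<lambda>x. f s x - g x)) \<longlongrightarrow> 0) F"
    using assms(1) by (auto simp: L2_tendsto_def)
  show "\<forall>\<^sub>F s in F. norm (L2_inner \<Omega> (f s) v - L2_inner \<Omega> g v)
      \<le> L2_norm \<Omega> (\<lambda>x. f s x - g x) * L2_norm \<Omega> v"
    using ev
  proof eventually_elim
    case (elim s)
    show ?case
      using L2_Cauchy_Schwarz[OF L2_diff[OF elim g] assms(2)]
      by (simp add: L2_inner_diff_left elim g assms(2))
  qed
  show "((\<lambda>s. L2_norm \<Omega> (\<lambda>x. f s x - g x) * L2_norm \<Omega> v) \<longlongrightarrow> 0) F"
    using tendsto_mult_left_zero[OF lim] .
qed

lemma finite_measure_lebesgue_on:
  fixes \<Omega> :: "'a::euclidean_space set"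
  shows "\<Omega> \<in> lmeasurable \<Longrightarrow> finite_measure (lebesgue_on \<Omega>)"
  by (rule finite_measureI) (auto simp: emeasure_restrict_space fmeasurable_def)

lemma constant_one_L2:
  fixes \<Omega> :: "'a::euclidean_space set"
  assumes "\<Omega> \<in> lmeasurable" shows "(\<lambda>x. 1) \<in> L2_space \<Omega>"
  using finite_measure.integrable_const[OF finite_measure_lebesgue_on[OF assms], of "1::real"]
  by (simp add: L2_space_def)

text \<open>
  Riesz--Fischer. On a set of finite measure the \<open>L\<^sup>2\<close> norm controls the \<open>L\<^sup>1\<close> norm, so a rapidly
  convergent subsequence has absolutely summable increments almost everywhere; its pointwise limit
  is the norm limit of the whole sequence by Fatou's lemma.
\<close>

lemma L2_complete:
  fixes \<Omega> :: "'a::euclidean_space set"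
  assumes fin: "\<Omega> \<in> lmeasurable"
    and L2: "\<And>n. f n \<in> L2_space \<Omega>"
    and Cauchy: "\<And>\<epsilon>. \<epsilon> > 0 \<Longrightarrow> \<exists>N. \<forall>m\<ge>N. \<forall>n\<ge>N. L2_norm \<Omega> (\<lambda>x. f m x - f n x) < \<epsilon>"
  shows "\<exists>g. L2_tendsto \<Omega> f g sequentially"
proof -
  let ?M = "lebesgue_on \<Omega>"
  note one = constant_one_L2[OF fin]
  define K where "K = L2_norm \<Omega> (\<lambda>x. 1)"
  have "\<forall>k. \<exists>N. \<forall>m\<ge>N. \<forall>n\<ge>N. L2_norm \<Omega> (\<lambda>x. f m x - f n x) < (1/2)^k"
    using Cauchy by simp
  then obtain N where N: "\<And>k m n. m \<ge> N k \<Longrightarrow> n \<ge> N k \<Longrightarrow> L2_norm \<Omega> (\<lambda>x. f m x - f n x) < (1/2)^k"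
    by metis
  \<comment> \<open>The partial sums make the subsequence monotone, the summand \<open>k\<close> makes it unbounded.\<close>
  define r where "r k = (\<Sum>i\<le>k. N i) + k" for k
  have rN: "N k \<le> r k" for k
    unfolding r_def by (rule trans_le_add1, rule member_le_sum) auto
  have rmono: "r k \<le> r (Suc k)" for k by (simp add: r_def)
  have rk: "k \<le> r k" for k by (simp add: r_def)
  define d where "d k x = \<bar>f (r (Suc k)) x - f (r k) x\<bar>" for k x
  have dL2: "(\<lambda>x. f (r (Suc k)) x - f (r k) x) \<in> L2_space \<Omega>" for k
    by (intro L2_diff L2)
  have dmeas [measurable]: "d k \<in> borel_measurable ?M" for k
    unfolding d_def using dL2[of k] by (auto dest: L2_measurable)
  have dabs: "(\<lambda>x. d k x) \<in> L2_space \<Omega>" for k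
    using dL2[of k] dmeas[of k] by (auto simp: L2_space_def d_def)
  have dint: "integrable ?M (d k)" for k
    using L2_mult_integrable[OF dabs one] by simp
  have dle: "(\<integral>x. d k x \<partial>?M) \<le> (1/2)^k * K" for k
  proof -
    have "(\<integral>x. d k x \<partial>?M) = L2_inner \<Omega> (d k) (\<lambda>x. 1)" by (simp add: L2_inner_def)
    also have "\<dots> \<le> L2_norm \<Omega> (d k) * K"
      using L2_Cauchy_Schwarz[OF dabs one, of k] by (simp add: K_def)
    also have "L2_norm \<Omega> (d k) = L2_norm \<Omega> (\<lambda>x. f (r (Suc k)) x - f (r k) x)"
      by (simp add: L2_norm_def L2_inner_def d_def flip: abs_mult)
    also have "\<dots> * K \<le> (1/2)^k * K"
      using N[of k "r (Suc k)" "r k"] rN[of k] rmono[of k]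
      by (intro mult_right_mono) (auto simp: K_def intro: less_imp_le)
    finally show ?thesis .
  qed
  have "(\<integral>\<^sup>+x. (\<Sum>k. ennreal (d k x)) \<partial>?M) = (\<Sum>k. \<integral>\<^sup>+x. ennreal (d k x) \<partial>?M)"
    by (rule nn_integral_suminf) measurable
  also have "\<dots> = (\<Sum>k. ennreal (\<integral>x. d k x \<partial>?M))"
    by (intro suminf_cong nn_integral_eq_integral dint) (simp add: d_def)
  also have "\<dots> \<le> (\<Sum>k. ennreal ((1/2)^k * K))"
    by (intro suminf_le ennreal_leI dle) auto
  also have "\<dots> = ennreal (\<Sum>k. (1/2)^k * K)"
    by (intro suminf_ennreal2) (auto simp: K_def intro!: summable_mult2 summable_geometric)
  also have "\<dots> < \<infinity>" by simp
  finally have "AE x in ?M. (\<Sum>k. ennreal (d k x)) \<noteq> \<infinity>"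
    by (intro nn_integral_PInf_AE) auto
  then have conv: "AE x in ?M. (\<lambda>k. f (r k) x) \<longlonglongrightarrow> lim (\<lambda>k. f (r k) x)"
  proof (rule AE_mp, intro AE_I2 impI)
    fix x assume "(\<Sum>k. ennreal (d k x)) \<noteq> \<infinity>"
    then have "summable (\<lambda>k. d k x)"
      by (intro summable_suminf_not_top) (auto simp: d_def)
    then have "summable (\<lambda>k. f (r (Suc k)) x - f (r k) x)"
      unfolding d_def by (rule summable_rabs_cancel)
    then have "convergent (\<lambda>n. \<Sum>k<n. f (r (Suc k)) x - f (r k) x)"
      by (simp add: summable_iff_convergent)
    then have "convergent (\<lambda>n. f (r n) x - f (r 0) x)"
      by (simp add: sum_lessThan_telescope[of "\<lambda>k. f (r k) x"])
    then have "convergent (\<lambda>n. f (r n) x)"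
      using convergent_add[OF _ convergent_const[of "f (r 0) x"]] by fastforce
    then show "(\<lambda>k. f (r k) x) \<longlonglongrightarrow> lim (\<lambda>k. f (r k) x)"
      by (simp add: convergent_LIMSEQ_iff)
  qed
  define g where "g x = lim (\<lambda>k. f (r k) x)" for x
  have [measurable]: "f n \<in> borel_measurable ?M" for n using L2 L2_measurable by blast
  have [measurable]: "g \<in> borel_measurable ?M"
    unfolding g_def by (rule borel_measurable_lim_metric) simp
  have fatou: "(\<integral>\<^sup>+x. ennreal ((f m x - g x)\<^sup>2) \<partial>?M) \<le> ennreal (\<epsilon>\<^sup>2)"
    if "\<epsilon> > 0" and M: "\<And>n. n \<ge> M \<Longrightarrow> L2_norm \<Omega> (\<lambda>x. f m x - f n x) \<le> \<epsilon>" for \<epsilon> m M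
  proof -
    have "(\<integral>\<^sup>+x. ennreal ((f m x - g x)\<^sup>2) \<partial>?M)
        = (\<integral>\<^sup>+x. liminf (\<lambda>k. ennreal ((f m x - f (r k) x)\<^sup>2)) \<partial>?M)"
    proof (rule nn_integral_cong_AE, use conv in \<open>rule AE_mp\<close>, intro AE_I2 impI)
      fix x assume "(\<lambda>k. f (r k) x) \<longlonglongrightarrow> lim (\<lambda>k. f (r k) x)"
      then have "(\<lambda>k. ennreal ((f m x - f (r k) x)\<^sup>2)) \<longlonglongrightarrow> ennreal ((f m x - g x)\<^sup>2)"
        unfolding g_def by (intro tendsto_intros)
      then show "ennreal ((f m x - g x)\<^sup>2) = liminf (\<lambda>k. ennreal ((f m x - f (r k) x)\<^sup>2))"
        by (rule lim_imp_Liminf[OF sequentially_bot, symmetric])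
    qed
    also have "\<dots> \<le> liminf (\<lambda>k. \<integral>\<^sup>+x. ennreal ((f m x - f (r k) x)\<^sup>2) \<partial>?M)"
      by (rule nn_integral_liminf) measurable
    also have "\<dots> \<le> ennreal (\<epsilon>\<^sup>2)"
    proof -
      have "\<forall>\<^sub>F k in sequentially. (\<integral>\<^sup>+x. ennreal ((f m x - f (r k) x)\<^sup>2) \<partial>?M) \<le> ennreal (\<epsilon>\<^sup>2)"
        using eventually_ge_at_top[of M]
      proof eventually_elim
        case (elim k)
        have "(\<integral>\<^sup>+x. ennreal ((f m x - f (r k) x)\<^sup>2) \<partial>?M)
            = ennreal (L2_inner \<Omega> (\<lambda>x. f m x - f (r k) x) (\<lambda>x. f m x - f (r k) x))"
          unfolding L2_inner_def power2_eq_square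
          by (intro nn_integral_eq_integral L2_mult_integrable L2_diff L2) auto
        also have "\<dots> = ennreal ((L2_norm \<Omega> (\<lambda>x. f m x - f (r k) x))\<^sup>2)"
          by (simp add: L2_norm_square)
        also have "\<dots> \<le> ennreal (\<epsilon>\<^sup>2)"
          using elim rk[of k] M[of "r k"] by (intro ennreal_leI power_mono) auto
        finally show ?case .
      qed
      then show ?thesis
        by (rule Liminf_le[OF sequentially_bot])
    qed
    finally show ?thesis .
  qed
  have close: "(\<lambda>x. f m x - g x) \<in> L2_space \<Omega> \<and> L2_norm \<Omega> (\<lambda>x. f m x - g x) \<le> \<epsilon>"
    if "\<epsilon> > 0" and M: "\<And>n. n \<ge> M \<Longrightarrow> L2_norm \<Omega> (\<lambda>x. f m x - f n x) \<le> \<epsilon>" for \<epsilon> m M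
  proof -
    have fat: "(\<integral>\<^sup>+x. ennreal ((f m x - g x)\<^sup>2) \<partial>?M) \<le> ennreal (\<epsilon>\<^sup>2)"
      by (rule fatou[OF that(1), of M m]) (rule M)
    then have int: "integrable ?M (\<lambda>x. (f m x - g x)\<^sup>2)"
      by (intro integrableI_bounded) (auto intro: le_less_trans)
    then have "ennreal (\<integral>x. (f m x - g x)\<^sup>2 \<partial>?M) \<le> ennreal (\<epsilon>\<^sup>2)"
      using fat by (subst nn_integral_eq_integral[symmetric]) auto
    then have "(L2_norm \<Omega> (\<lambda>x. f m x - g x))\<^sup>2 \<le> \<epsilon>\<^sup>2"
      unfolding L2_norm_square L2_inner_def power2_eq_square[of "f m x - g x" for x, symmetric]
      by (subst (asm) ennreal_le_iff) simp_all
    then have "L2_norm \<Omega> (\<lambda>x. f m x - g x) \<le> \<epsilon>"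
      by (rule power2_le_imp_le) (use that(1) in simp)
    moreover have "(\<lambda>x. f m x - g x) \<in> L2_space \<Omega>" using int by (simp add: L2_space_def)
    ultimately show ?thesis by simp
  qed
  have gL2: "g \<in> L2_space \<Omega>"
  proof -
    obtain M where "\<And>n. n \<ge> M \<Longrightarrow> L2_norm \<Omega> (\<lambda>x. f M x - f n x) < 1"
      using Cauchy[of 1] by auto
    then have "(\<lambda>x. f M x - g x) \<in> L2_space \<Omega>"
      using close[of 1 M M] by (auto intro: less_imp_le)
    from L2_diff[OF L2[of M] this] show ?thesis by simp
  qed
  have "(\<lambda>m. L2_norm \<Omega> (\<lambda>x. f m x - g x)) \<longlonglongrightarrow> 0"
  proof (rule LIMSEQ_I)
    fix \<epsilon> :: real assume "\<epsilon> > 0"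
    then obtain M where M: "\<And>m n. m \<ge> M \<Longrightarrow> n \<ge> M \<Longrightarrow> L2_norm \<Omega> (\<lambda>x. f m x - f n x) < \<epsilon>/2"
      using Cauchy[of "\<epsilon>/2"] by auto
    have "norm (L2_norm \<Omega> (\<lambda>x. f m x - g x) - 0) < \<epsilon>" if "m \<ge> M" for m
      using close[of "\<epsilon>/2" M m, OF _ less_imp_le[OF M[OF that]]] \<open>\<epsilon> > 0\<close> by simp
    then show "\<exists>M. \<forall>m\<ge>M. norm (L2_norm \<Omega> (\<lambda>x. f m x - g x) - 0) < \<epsilon>" by blast
  qed
  then have "L2_tendsto \<Omega> f g sequentially"
    using gL2 L2 by (simp add: L2_tendsto_def)
  then show ?thesis by blast
qed

section \<open>Smooth functions and test functions\<close>

text \<open>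
  A class of differentiable functions closed under partial derivatives consists of smooth functions;
  this replaces inductions over the order of differentiability.
\<close>

lemma smooth_fun_coinduct:
  assumes "Q f"
    and step: "\<And>f. Q f \<Longrightarrow> (\<forall>x. f differentiable (at x)) \<and>
      (\<forall>i\<in>Basis. Q (\<lambda>x. frechet_derivative f (at x) i))"
  shows "smooth_fun f"
proof -
  have "C_diff k f" if "Q f" for k f
    using that
  proof (induction k arbitrary: f)
    case 0
    then show ?case
      using step by (auto intro!: continuous_at_imp_continuous_on differentiable_imp_continuous_within)
  next
    case (Suc k)
    then show ?case using step by auto
  qed
  with assms(1) show ?thesis by (simp add: smooth_fun_def)
qed

lemma smooth_fun_differentiable: "smooth_fun f \<Longrightarrow> f differentiable (at x)"
  unfolding smooth_fun_def by (metis C_diff.simps(2))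

lemma smooth_fun_partial:
  "smooth_fun f \<Longrightarrow> i \<in> Basis \<Longrightarrow> smooth_fun (\<lambda>x. frechet_derivative f (at x) i)"
  unfolding smooth_fun_def by (metis C_diff.simps(2))

lemma smooth_fun_continuous: "smooth_fun f \<Longrightarrow> continuous_on UNIV f"
  unfolding smooth_fun_def by (metis C_diff.simps(1))

lemma smooth_fun_has_derivative:
  "smooth_fun f \<Longrightarrow> (f has_derivative frechet_derivative f (at x)) (at x)"
  using smooth_fun_differentiable frechet_derivative_works by blast

text \<open>
  The powers of \<open>1/x\<close> make this family closed under differentiation, so that smoothness of
  \<open>exp (-1/x)\<close> across \<open>0\<close> needs no explicit higher derivatives.
\<close>

definition flat_exp :: "nat \<Rightarrow> real \<Rightarrow> real" where
  "flat_exp n x = (if 0 < x then exp (- 1 / x) / x ^ n else 0)"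

lemma flat_exp_tendsto_0: "(flat_exp n \<longlongrightarrow> 0) (at 0)"
proof -
  have "((\<lambda>x. (inverse x) ^ n / exp (inverse x)) \<longlongrightarrow> (0::real)) (at_right 0)"
    by (rule filterlim_compose[OF tendsto_power_div_exp_0 filterlim_inverse_at_top_right])
  moreover have "\<forall>\<^sub>F x in at_right 0. (inverse x) ^ n / exp (inverse x) = flat_exp n x"
    using eventually_at_right_less[of 0]
    by eventually_elim (simp add: flat_exp_def exp_minus field_simps)
  ultimately have "(flat_exp n \<longlongrightarrow> 0) (at_right 0)"
    by (rule Lim_transform_eventually)
  moreover have "(flat_exp n \<longlongrightarrow> 0) (at_left 0)"
  proof (rule Lim_transform_eventually[OF tendsto_const])
    show "\<forall>\<^sub>F x in at_left 0. 0 = flat_exp n x"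
      by (auto simp: eventually_at_filter flat_exp_def)
  qed
  ultimately show ?thesis by (simp add: filterlim_at_split)
qed

lemma flat_exp_deriv:
  "(flat_exp n has_real_derivative flat_exp (n + 2) x - real n * flat_exp (n + 1) x) (at x)"
proof -
  consider "x > 0" | "x < 0" | "x = 0" by linarith
  then show ?thesis
  proof cases
    case 1
    have "((\<lambda>x. exp (- 1 / x) / x ^ n) has_real_derivative
        flat_exp (n + 2) x - real n * flat_exp (n + 1) x) (at x)"
    proof (rule DERIV_cong)
      show "((\<lambda>x. exp (- 1 / x) / x ^ n) has_real_derivative
          (exp (- 1 / x) * (1 / x\<^sup>2) * x ^ n - exp (- 1 / x) * (real n * x ^ (n - Suc 0))) / (x ^ n * x ^ n))
          (at x)"
        using 1 by (auto intro!: derivative_eq_intros simp: power2_eq_square)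
      have pw: "real n * x ^ (n - Suc 0) = real n * (x ^ n / x)"
        using 1 by (cases n) simp_all
      show "(exp (- 1 / x) * (1 / x\<^sup>2) * x ^ n - exp (- 1 / x) * (real n * x ^ (n - Suc 0)))
          / (x ^ n * x ^ n) = flat_exp (n + 2) x - real n * flat_exp (n + 1) x"
        unfolding pw using 1 by (simp add: flat_exp_def field_simps power2_eq_square)
    qed
    then show ?thesis
      by (rule has_field_derivative_transform_within_open[of _ _ _ "{0<..}"])
        (use 1 in \<open>auto simp: flat_exp_def\<close>)
  next
    case 2
    have "((\<lambda>x. 0) has_real_derivative flat_exp (n + 2) x - real n * flat_exp (n + 1) x) (at x)"
      using 2 by (simp add: flat_exp_def)
    then show ?thesis
      by (rule has_field_derivative_transform_within_open[of _ _ _ "{..<0}"])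
        (use 2 in \<open>auto simp: flat_exp_def\<close>)
  next
    case 3
    have "((\<lambda>h. (flat_exp n (0 + h) - flat_exp n 0) / h) \<longlongrightarrow> 0) (at 0)"
    proof (rule Lim_transform_eventually[OF flat_exp_tendsto_0[of "Suc n"]])
      show "\<forall>\<^sub>F h in at 0. flat_exp (Suc n) h = (flat_exp n (0 + h) - flat_exp n 0) / h"
        by (auto simp: eventually_at_filter flat_exp_def)
    qed
    then show ?thesis using 3 by (simp add: DERIV_def flat_exp_def)
  qed
qed

text \<open>
  Smoothness is proved for the whole algebra generated by smooth functions, linear forms and
  compositions with \<open>flat_exp\<close>, because a partial derivative of a product or of a composition
  involves derivatives and undifferentiated factors at once.
\<close>

inductive smooth_gen :: "('a::euclidean_space \<Rightarrow> real) \<Rightarrow> bool" where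
  base: "smooth_fun f \<Longrightarrow> smooth_gen f"
| const: "smooth_gen (\<lambda>x. c)"
| linear: "smooth_gen (\<lambda>x. x \<bullet> b)"
| add: "smooth_gen f \<Longrightarrow> smooth_gen g \<Longrightarrow> smooth_gen (\<lambda>x. f x + g x)"
| mult: "smooth_gen f \<Longrightarrow> smooth_gen g \<Longrightarrow> smooth_gen (\<lambda>x. f x * g x)"
| flat_exp: "smooth_gen f \<Longrightarrow> smooth_gen (\<lambda>x. flat_exp n (f x))"

lemma partial_eqI:
  "(f has_derivative D) (at x) \<Longrightarrow> frechet_derivative f (at x) i = D i"
  by (metis frechet_derivative_at)

lemma smooth_genI_partials:
  assumes "\<And>x. (f has_derivative D x) (at x)" "\<And>i. i \<in> Basis \<Longrightarrow> smooth_gen (\<lambda>x. D x i)"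
  shows "(\<forall>x. f differentiable (at x)) \<and>
    (\<forall>i\<in>Basis. smooth_gen (\<lambda>x. frechet_derivative f (at x) i))"
  using assms(2) by (simp add: partial_eqI[OF assms(1)]) (meson assms(1) differentiableI)

lemma smooth_gen_partials:
  assumes "smooth_gen f"
  shows "(\<forall>x. f differentiable (at x)) \<and>
    (\<forall>i\<in>Basis. smooth_gen (\<lambda>x. frechet_derivative f (at x) i))"
  using assms
proof induction
  case (base f)
  then show ?case
    by (auto intro: smooth_fun_differentiable smooth_gen.base smooth_fun_partial)
next
  case (const c)
  show ?case
    by (rule smooth_genI_partials[of _ "\<lambda>x h. 0"]) (auto intro: smooth_gen.const)
next
  case (linear b)
  show ?case
    by (rule smooth_genI_partials[of _ "\<lambda>x h. h \<bullet> b"])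
      (auto intro!: derivative_eq_intros smooth_gen.const)
next
  case (add f g)
  then show ?case
    by (intro smooth_genI_partials[of _ "\<lambda>x h. frechet_derivative f (at x) h + frechet_derivative g (at x) h"]
        has_derivative_add smooth_gen.add)
      (auto simp: frechet_derivative_works)
next
  case (mult f g)
  then show ?case
    by (intro smooth_genI_partials[of _ "\<lambda>x h. f x * frechet_derivative g (at x) h + frechet_derivative f (at x) h * g x"]
        has_derivative_mult smooth_gen.add smooth_gen.mult)
      (auto simp: frechet_derivative_works)
next
  case (flat_exp f n)
  let ?D = "\<lambda>x. flat_exp (n + 2) (f x) + (- real n) * flat_exp (n + 1) (f x)"
  have "((\<lambda>x. flat_exp n (f x)) has_derivative (\<lambda>h. ?D x * frechet_derivative f (at x) h)) (at x)" for x
  proof -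
    have "(flat_exp n has_derivative (*) (?D x)) (at (f x))"
      using flat_exp_deriv[of n "f x"] by (simp add: has_field_derivative_def)
    moreover have "(f has_derivative frechet_derivative f (at x)) (at x)"
      using flat_exp.IH by (simp add: frechet_derivative_works)
    ultimately show ?thesis
      using has_derivative_compose by fastforce
  qed
  then show ?case
    using flat_exp
    by (intro smooth_genI_partials[of _ "\<lambda>x h. ?D x * frechet_derivative f (at x) h"]
        smooth_gen.add smooth_gen.mult smooth_gen.const smooth_gen.flat_exp) auto
qed

lemma smooth_gen_smooth: "smooth_gen f \<Longrightarrow> smooth_fun f"
  by (rule smooth_fun_coinduct[of smooth_gen]) (auto dest: smooth_gen_partials)

lemma smooth_fun_const: "smooth_fun (\<lambda>x. c)"
  by (rule smooth_gen_smooth) (intro smooth_gen.const)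

lemma smooth_fun_add: "smooth_fun f \<Longrightarrow> smooth_fun g \<Longrightarrow> smooth_fun (\<lambda>x. f x + g x)"
  by (rule smooth_gen_smooth) (intro smooth_gen.add smooth_gen.base)

lemma smooth_fun_mult: "smooth_fun f \<Longrightarrow> smooth_fun g \<Longrightarrow> smooth_fun (\<lambda>x. f x * g x)"
  by (rule smooth_gen_smooth) (intro smooth_gen.mult smooth_gen.base)

lemma smooth_fun_diff: "smooth_fun f \<Longrightarrow> smooth_fun g \<Longrightarrow> smooth_fun (\<lambda>x. f x - g x)"
  using smooth_fun_add[OF _ smooth_fun_mult[OF smooth_fun_const[of "-1"]], of f g] by simp

lemma smooth_fun_sum:
  "(\<And>i. i \<in> I \<Longrightarrow> smooth_fun (f i)) \<Longrightarrow> smooth_fun (\<lambda>x. \<Sum>i\<in>I. f i x)"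
  by (induction I rule: infinite_finite_induct) (auto intro: smooth_fun_const smooth_fun_add)

lemma smooth_fun_prod:
  "(\<And>i. i \<in> I \<Longrightarrow> smooth_fun (f i)) \<Longrightarrow> smooth_fun (\<lambda>x. \<Prod>i\<in>I. f i x)"
  by (induction I rule: infinite_finite_induct) (auto intro: smooth_fun_const smooth_fun_mult)

lemma smooth_fun_linear: "smooth_fun (\<lambda>x. x \<bullet> b)"
  by (rule smooth_gen_smooth) (intro smooth_gen.linear)

lemma smooth_fun_flat_exp: "smooth_fun f \<Longrightarrow> smooth_fun (\<lambda>x. flat_exp n (f x))"
  by (rule smooth_gen_smooth) (intro smooth_gen.flat_exp smooth_gen.base)

lemma smooth_fun_dist_square: "smooth_fun (\<lambda>x. (dist x c)\<^sup>2)"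
proof -
  have eq: "(dist x c)\<^sup>2 = (\<Sum>i\<in>Basis. (x \<bullet> i - c \<bullet> i) * (x \<bullet> i - c \<bullet> i))" for x
    unfolding dist_norm power2_norm_eq_inner euclidean_inner[of "x - c" "x - c"]
    by (simp add: inner_diff_left)
  show ?thesis
    unfolding eq by (intro smooth_fun_sum smooth_fun_mult smooth_fun_diff smooth_fun_linear smooth_fun_const)
qed

lemma test_fun_smooth: "test_fun \<Omega> \<phi> \<Longrightarrow> smooth_fun \<phi>"
  by (simp add: test_fun_def)

lemma test_funI:
  assumes "smooth_fun \<phi>" "compact K" "K \<subseteq> \<Omega>" "\<And>x. \<phi> x \<noteq> 0 \<Longrightarrow> x \<in> K"
  shows "test_fun \<Omega> \<phi>"
proof -
  have "closure {x. \<phi> x \<noteq> 0} \<subseteq> K"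
    using assms by (intro closure_minimal compact_imp_closed) auto
  moreover from this have "compact (closure {x. \<phi> x \<noteq> 0})"
    using compact_Int_closed[OF assms(2) closed_closure, of "{x. \<phi> x \<noteq> 0}"]
    by (simp add: inf.absorb2)
  ultimately show ?thesis
    using assms(1,3) unfolding test_fun_def by blast
qed

lemma test_fun_support:
  assumes "test_fun \<Omega> \<phi>"
  obtains K where "compact K" "K \<subseteq> \<Omega>" "\<And>x. \<phi> x \<noteq> 0 \<Longrightarrow> x \<in> K"
proof (rule that)
  show "compact (closure {x. \<phi> x \<noteq> 0})" "closure {x. \<phi> x \<noteq> 0} \<subseteq> \<Omega>"
    using assms by (auto simp: test_fun_def)
  show "x \<in> closure {x. \<phi> x \<noteq> 0}" if "\<phi> x \<noteq> 0" for x
    using that closure_subset[of "{x. \<phi> x \<noteq> 0}"] by auto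
qed

lemma test_fun_mono: "test_fun U \<phi> \<Longrightarrow> U \<subseteq> \<Omega> \<Longrightarrow> test_fun \<Omega> \<phi>"
  by (auto simp: test_fun_def)

lemma test_fun_add:
  assumes "test_fun \<Omega> \<phi>" "test_fun \<Omega> \<psi>" shows "test_fun \<Omega> (\<lambda>x. \<phi> x + \<psi> x)"
proof -
  obtain K where K: "compact K" "K \<subseteq> \<Omega>" "\<And>x. \<phi> x \<noteq> 0 \<Longrightarrow> x \<in> K"
    using assms(1) by (rule test_fun_support) blast
  obtain L where L: "compact L" "L \<subseteq> \<Omega>" "\<And>x. \<psi> x \<noteq> 0 \<Longrightarrow> x \<in> L"
    using assms(2) by (rule test_fun_support) blast
  show ?thesis
  proof (rule test_funI)
    show "smooth_fun (\<lambda>x. \<phi> x + \<psi> x)"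
      using assms by (intro smooth_fun_add test_fun_smooth)
    show "compact (K \<union> L)" "K \<union> L \<subseteq> \<Omega>" using K L by auto
    show "x \<in> K \<union> L" if "\<phi> x + \<psi> x \<noteq> 0" for x
      using K(3)[of x] L(3)[of x] that by (cases "\<phi> x = 0") auto
  qed
qed

lemma test_fun_mult:
  assumes "test_fun \<Omega> \<phi>" "smooth_fun \<psi>" shows "test_fun \<Omega> (\<lambda>x. \<psi> x * \<phi> x)"
proof -
  obtain K where K: "compact K" "K \<subseteq> \<Omega>" "\<And>x. \<phi> x \<noteq> 0 \<Longrightarrow> x \<in> K"
    using assms(1) by (rule test_fun_support) blast
  show ?thesis
  proof (rule test_funI[OF _ K(1,2)])
    show "smooth_fun (\<lambda>x. \<psi> x * \<phi> x)"
      by (rule smooth_fun_mult[OF assms(2) test_fun_smooth[OF assms(1)]])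
    show "x \<in> K" if "\<psi> x * \<phi> x \<noteq> 0" for x using K(3)[of x] that by simp
  qed
qed

lemma test_fun_zero: "test_fun \<Omega> (\<lambda>x. 0)"
  by (rule test_funI[of _ "{}"]) (auto intro: smooth_fun_const)

lemma frechet_derivative_zero_off_support:
  assumes "compact K" "\<And>x. \<phi> x \<noteq> 0 \<Longrightarrow> x \<in> K" "x \<notin> K"
  shows "frechet_derivative \<phi> (at x) i = (0::real)"
proof (rule partial_eqI)
  show "(\<phi> has_derivative (\<lambda>h. 0)) (at x)"
    by (rule has_derivative_transform_within_open[of "\<lambda>x. 0" _ _ _ "- K"])
      (use assms in \<open>auto intro: compact_imp_closed\<close>)
qed

lemma test_fun_partial:
  assumes "test_fun \<Omega> \<phi>" "i \<in> Basis"
  shows "test_fun \<Omega> (\<lambda>x. frechet_derivative \<phi> (at x) i)"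
proof -
  obtain K where K: "compact K" "K \<subseteq> \<Omega>" "\<And>x. \<phi> x \<noteq> 0 \<Longrightarrow> x \<in> K"
    using assms(1) by (rule test_fun_support) blast
  with frechet_derivative_zero_off_support[OF K(1,3)] show ?thesis
    by (intro test_funI[of _ K] smooth_fun_partial assms test_fun_smooth[OF assms(1)]) auto
qed

lemma test_fun_bounded:
  assumes "test_fun \<Omega> \<phi>"
  obtains B where "\<And>x. \<bar>\<phi> x\<bar> \<le> B"
proof -
  obtain K where K: "compact K" "K \<subseteq> \<Omega>" "\<And>x. \<phi> x \<noteq> 0 \<Longrightarrow> x \<in> K"
    using assms by (rule test_fun_support) blast
  have "bounded (\<phi> ` K)"
    using K(1) continuous_on_subset[OF smooth_fun_continuous[OF test_fun_smooth[OF assms]]]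
    by (intro compact_imp_bounded compact_continuous_image) auto
  then obtain B where "0 < B" and B: "\<And>x. x \<in> K \<Longrightarrow> \<bar>\<phi> x\<bar> \<le> B"
    by (auto simp: bounded_pos)
  then have "\<bar>\<phi> x\<bar> \<le> B" for x
    using K(3)[of x] by (cases "\<phi> x = 0") auto
  then show ?thesis by (rule that)
qed

lemma lebesgue_measurable_continuous:
  fixes f :: "'a::euclidean_space \<Rightarrow> real"
  assumes "continuous_on UNIV f" shows "f \<in> borel_measurable (lebesgue_on \<Omega>)"
  using borel_measurable_continuous_onI[OF assms]
  by (intro measurable_restrict_space1 measurable_completion) simp

lemma test_fun_L2:
  fixes \<Omega> :: "'a::euclidean_space set"
  assumes "\<Omega> \<in> lmeasurable" "test_fun \<Omega> \<phi>" shows "\<phi> \<in> L2_space \<Omega>"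
proof -
  obtain B where B: "\<And>x. \<bar>\<phi> x\<bar> \<le> B" using assms(2) by (rule test_fun_bounded) blast
  have meas: "\<phi> \<in> borel_measurable (lebesgue_on \<Omega>)"
    by (intro lebesgue_measurable_continuous smooth_fun_continuous test_fun_smooth[OF assms(2)])
  note fm = finite_measure_lebesgue_on[OF assms(1)]
  have "(\<phi> x)\<^sup>2 \<le> B\<^sup>2" for x using B by (metis abs_le_square_iff abs_of_nonneg abs_ge_zero order_trans)
  then have "integrable (lebesgue_on \<Omega>) (\<lambda>x. (\<phi> x)\<^sup>2)"
    using meas by (intro finite_measure.integrable_const_bound[OF fm, of _ "B\<^sup>2"]) auto
  with meas show ?thesis by (simp add: L2_space_def)
qed

text \<open>
  \<open>U\<close> is a countable union of balls whose closures lie in \<open>U\<close>. On a ball given by \<open>q > 0\<close>, the smooth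
  functions \<open>exp (-1 / (n q))\<close> increase to \<open>1\<close>; complements of products turn the functions of the
  first \<open>n\<close> balls into one function for their union.
\<close>

lemma open_indicator_approx:
  fixes U :: "'a::euclidean_space set"
  assumes "open U"
  obtains \<psi> :: "nat \<Rightarrow> 'a \<Rightarrow> real"
  where "\<And>n. test_fun U (\<psi> n)" "\<And>n x. 0 \<le> \<psi> n x \<and> \<psi> n x \<le> 1"
    "\<And>x. (\<lambda>n. \<psi> n x) \<longlonglongrightarrow> indicator U x"
proof (cases "U = {}")
  case True
  then show ?thesis by (intro that[of "\<lambda>n x. 0"]) (auto intro: test_fun_zero)
next
  case False
  define I where "I = {(c, r). 0 < r \<and> cball c r \<subseteq> U}"
  have UI: "(\<Union>(c, r)\<in>I. ball c r) = U"
  proof (intro antisym subsetI)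
    fix x assume "x \<in> U"
    then obtain r where "r > 0" "cball x r \<subseteq> U" using assms open_contains_cball by blast
    then have "(x, r) \<in> I" "x \<in> ball x r" by (auto simp: I_def)
    then show "x \<in> (\<Union>(c, r)\<in>I. ball c r)" by blast
  qed (force simp: I_def)
  obtain F where F: "F \<subseteq> (\<lambda>(c, r). ball c r) ` I" "countable F" "\<Union>F = U"
  proof (rule Lindelof)
    show "open S" if "S \<in> (\<lambda>(c, r). ball c r) ` I" for S using that by auto
  qed (use UI that in auto)
  obtain I' where I': "countable I'" "I' \<subseteq> I" "F = (\<lambda>(c, r). ball c r) ` I'"
    using F(1,2) by (metis countable_subset_image)
  have ne: "I' \<noteq> {}" using False F(3) I'(3) by auto
  define c r where "c k = fst (from_nat_into I' k)" and "r k = snd (from_nat_into I' k)" for k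
  have crI: "(c k, r k) \<in> I" for k
    using from_nat_into[OF ne] I'(2) by (auto simp: c_def r_def)
  have cov: "\<exists>k. x \<in> ball (c k) (r k)" if "x \<in> U" for x
  proof -
    from that obtain p where "p \<in> I'" "x \<in> ball (fst p) (snd p)"
      using F(3) I'(3) by (auto simp: case_prod_beta)
    then show ?thesis
      using from_nat_into_surj[OF I'(1)] unfolding c_def r_def by metis
  qed
  define q where "q k x = (r k)\<^sup>2 - (dist x (c k))\<^sup>2" for k x
  have q_pos: "0 < q k x \<longleftrightarrow> x \<in> ball (c k) (r k)" for k x
    using crI[of k] by (auto simp: q_def I_def dist_commute abs_le_square_iff[symmetric] not_le[symmetric])
  define b where "b n k x = flat_exp 0 (real n * q k x)" for n k x
  have b01: "0 \<le> b n k x" "b n k x \<le> 1" for n k x by (auto simp: b_def flat_exp_def)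
  have b_pos: "x \<in> ball (c k) (r k)" if "b n k x \<noteq> 0" for n k x
    using that q_pos[of k x] by (auto simp: b_def flat_exp_def zero_less_mult_iff split: if_splits)
  define \<psi> where "\<psi> n x = 1 - (\<Prod>k<n. 1 - b n k x)" for n x
  show ?thesis
  proof (rule that[of \<psi>])
    fix n
    show "test_fun U (\<psi> n)"
    proof (rule test_funI)
      show "smooth_fun (\<psi> n)"
        unfolding \<psi>_def b_def q_def
        by (intro smooth_fun_diff smooth_fun_const smooth_fun_prod smooth_fun_flat_exp
            smooth_fun_mult smooth_fun_dist_square)
      show "compact (\<Union>k<n. cball (c k) (r k))" by auto
      show "(\<Union>k<n. cball (c k) (r k)) \<subseteq> U" using crI by (auto simp: I_def)
      fix x assume "\<psi> n x \<noteq> 0"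
      then have "\<not> (\<forall>k<n. b n k x = 0)"
        by (intro notI) (simp add: \<psi>_def)
      then show "x \<in> (\<Union>k<n. cball (c k) (r k))" using b_pos by fastforce
    qed
    fix x
    have "0 \<le> (\<Prod>k<n. 1 - b n k x)" using b01 by (intro prod_nonneg) auto
    moreover have "(\<Prod>k<n. 1 - b n k x) \<le> 1" using b01 by (intro prod_le_1) auto
    ultimately show "0 \<le> \<psi> n x \<and> \<psi> n x \<le> 1" by (simp add: \<psi>_def)
  next
    fix x
    show "(\<lambda>n. \<psi> n x) \<longlonglongrightarrow> indicator U x"
    proof (cases "x \<in> U")
      case True
      then obtain k where "x \<in> ball (c k) (r k)" using cov by blast
      then have q: "0 < q k x" using q_pos by simp
      have "(\<lambda>n. 1 - exp (- 1 / (real n * q k x))) \<longlonglongrightarrow> 1 - exp 0"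
        using q by (intro tendsto_intros tendsto_divide_0[OF tendsto_const] filterlim_at_top_imp_at_infinity
            filterlim_at_top_mult_tendsto_pos[OF tendsto_const] filterlim_real_sequentially)
      then have lim: "(\<lambda>n. 1 - exp (- 1 / (real n * q k x))) \<longlonglongrightarrow> 0" by simp
      have "(\<lambda>n. (\<Prod>k<n. 1 - b n k x)) \<longlonglongrightarrow> 0"
      proof (rule tendsto_sandwich[OF _ _ tendsto_const lim])
        show "\<forall>\<^sub>F n in sequentially. 0 \<le> (\<Prod>k<n. 1 - b n k x)"
          using b01 by (intro always_eventually allI prod_nonneg) auto
        show "\<forall>\<^sub>F n in sequentially. (\<Prod>k<n. 1 - b n k x) \<le> 1 - exp (- 1 / (real n * q k x))"
          using eventually_gt_at_top[of k]
        proof eventually_elim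
          case (elim n)
          have "(\<Prod>k<n. 1 - b n k x) = (1 - b n k x) * (\<Prod>j\<in>{..<n} - {k}. 1 - b n j x)"
            using elim by (intro prod.remove) auto
          also have "\<dots> \<le> (1 - b n k x) * 1"
            using b01 by (intro mult_left_mono prod_le_1) auto
          also have "\<dots> = 1 - exp (- 1 / (real n * q k x))"
            using q elim by (simp add: b_def flat_exp_def)
          finally show ?case .
        qed
      qed
      then have "(\<lambda>n. \<psi> n x) \<longlonglongrightarrow> 1 - 0" unfolding \<psi>_def by (intro tendsto_intros)
      with True show ?thesis by simp
    next
      case False
      then have "b n k x = 0" for n k
        using b_pos[of n k x] crI[of k] by (cases "b n k x = 0") (auto simp: I_def subset_eq)
      with False show ?thesis by (simp add: \<psi>_def)
    qed
  qed
qed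

text \<open>
  The fundamental lemma of the calculus of variations: the integral of \<open>g\<close> vanishes over open sets,
  hence over the set where \<open>g\<close> is positive, which is a decreasing limit of open sets up to a null set.
  A nonnegative function with integral \<open>0\<close> vanishes almost everywhere.
\<close>

lemma nonpos_AE_if_orthogonal_test_fun:
  fixes \<Omega> :: "'a::euclidean_space set"
  assumes "open \<Omega>" and int: "integrable (lebesgue_on \<Omega>) g"
    and orth: "\<And>\<phi>. test_fun \<Omega> \<phi> \<Longrightarrow> (LINT x|lebesgue_on \<Omega>. g x * \<phi> x) = 0"
  shows "AE x in lebesgue_on \<Omega>. g x \<le> 0"
proof -
  let ?M = "lebesgue_on \<Omega>"
  have [measurable]: "g \<in> borel_measurable ?M" using int by auto
  have \<Omega>: "\<Omega> \<in> sets lebesgue" using assms(1) by auto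
  have setsM: "S \<inter> \<Omega> \<in> sets ?M" if "S \<in> sets lebesgue" for S
    using that \<Omega> by (auto simp: sets_restrict_space)
  have indmeas: "(indicator S :: 'a \<Rightarrow> real) \<in> borel_measurable ?M" if "S \<in> sets lebesgue" for S
    using that by (intro measurable_restrict_space1) simp
  have open0: "(LINT x|?M. g x * indicator (U \<inter> \<Omega>) x) = 0" if "open U" for U
  proof -
    have "open (U \<inter> \<Omega>)" using that assms(1) by auto
    then obtain \<psi> where \<psi>: "\<And>n. test_fun (U \<inter> \<Omega>) (\<psi> n)" "\<And>n x. 0 \<le> \<psi> n x \<and> \<psi> n x \<le> 1"
      "\<And>x. (\<lambda>n. \<psi> n x) \<longlonglongrightarrow> indicator (U \<inter> \<Omega>) x"
      by (rule open_indicator_approx) blast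
    have [measurable]: "\<psi> n \<in> borel_measurable ?M" for n
      by (intro lebesgue_measurable_continuous smooth_fun_continuous test_fun_smooth[OF \<psi>(1)])
    have [measurable]: "(indicator (U \<inter> \<Omega>) :: 'a \<Rightarrow> real) \<in> borel_measurable ?M"
      using \<open>open (U \<inter> \<Omega>)\<close> by (intro indmeas) auto
    have "(\<lambda>n. LINT x|?M. g x * \<psi> n x) \<longlonglongrightarrow> (LINT x|?M. g x * indicator (U \<inter> \<Omega>) x)"
    proof (rule integral_dominated_convergence[where w = "\<lambda>x. \<bar>g x\<bar>"])
      show "AE x in ?M. (\<lambda>n. g x * \<psi> n x) \<longlonglongrightarrow> g x * indicator (U \<inter> \<Omega>) x"
        by (intro AE_I2 tendsto_intros \<psi>)
      show "AE x in ?M. norm (g x * \<psi> n x) \<le> \<bar>g x\<bar>" for n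
        using \<psi>(2)[of n] by (intro AE_I2) (auto simp: abs_mult intro!: mult_left_le)
    qed (use int in auto)
    moreover have "(LINT x|?M. g x * \<psi> n x) = 0" for n
      by (intro orth test_fun_mono[OF \<psi>(1)]) auto
    ultimately show ?thesis by (simp add: LIMSEQ_const_iff)
  qed
  define P where "P = {x \<in> \<Omega>. 0 < g x}"
  have "P \<in> sets ?M" unfolding P_def using \<Omega> by measurable (auto simp: space_restrict_space)
  then have P: "P \<in> sets lebesgue"
    using \<Omega> by (auto simp: sets_restrict_space)
  \<comment> \<open>Up to a null set \<open>N\<close>, the set of positivity is the intersection of the open sets \<open>V n\<close>.\<close>
  obtain C N where "gdelta C" and N: "N \<in> null_sets lebesgue" and C: "P \<union> N = C"
    by (rule lebesgue_set_almost_gdelta[OF P]) blast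
  from \<open>gdelta C\<close> obtain T :: "nat \<Rightarrow> 'a set" where T: "\<And>n. open (T n)" "C = (\<Inter>n. T n)"
    by cases auto
  define V where "V n = (\<Inter>k\<le>n. T k)" for n
  have V: "open (V n)" "P \<subseteq> V n" for n
    using T C by (auto simp: V_def)
  from N have AEN: "AE x in ?M. x \<notin> N"
    using \<Omega> by (auto simp: AE_restrict_space_iff dest: AE_not_in)
  have "(\<lambda>n. LINT x|?M. g x * indicator (V n \<inter> \<Omega>) x) \<longlonglongrightarrow> (LINT x|?M. g x * indicator P x)"
  proof (rule integral_dominated_convergence[where w = "\<lambda>x. \<bar>g x\<bar>"])
    show "AE x in ?M. (\<lambda>n. g x * indicator (V n \<inter> \<Omega>) x) \<longlonglongrightarrow> g x * indicator P x"
      using AEN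
    proof (rule AE_mp, intro AE_I2 impI)
      fix x assume x: "x \<in> space ?M" "x \<notin> N"
      then have "x \<in> \<Omega>" by (simp add: space_restrict_space)
      have "\<forall>\<^sub>F n in sequentially. g x * indicator (V n \<inter> \<Omega>) x = g x * indicator P x"
      proof (cases "x \<in> P")
        case True
        then show ?thesis using V(2) \<open>x \<in> \<Omega>\<close> by (auto simp: indicator_def subset_eq)
      next
        case False
        then obtain m where "x \<notin> T m" using x C T(2) by auto
        with False show ?thesis
          by (intro eventually_sequentiallyI[of m]) (auto simp: V_def indicator_def)
      qed
      then show "(\<lambda>n. g x * indicator (V n \<inter> \<Omega>) x) \<longlonglongrightarrow> g x * indicator P x"
        by (rule tendsto_eventually)
    qed
    have "V n \<inter> \<Omega> \<in> sets lebesgue" for n using V(1) assms(1) by auto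
    then show "(\<lambda>x. g x * indicator (V n \<inter> \<Omega>) x) \<in> borel_measurable ?M" for n
      using indmeas by auto
    show "(\<lambda>x. g x * indicator P x) \<in> borel_measurable ?M"
      using indmeas[OF P] by auto
    show "AE x in ?M. norm (g x * indicator (V n \<inter> \<Omega>) x) \<le> \<bar>g x\<bar>" for n
      by (intro AE_I2) (auto simp: indicator_def)
  qed (use int in auto)
  then have P0: "(LINT x|?M. g x * indicator P x) = 0"
    using open0[OF V(1)] by (simp add: LIMSEQ_const_iff)
  have "integrable ?M (\<lambda>x. g x * indicator P x)"
  proof (rule Bochner_Integration.integrable_bound[OF int])
    show "(\<lambda>x. g x * indicator P x) \<in> borel_measurable ?M"
      using indmeas[OF P] by auto
    show "AE x in ?M. norm (g x * indicator P x) \<le> norm (g x)"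
      by (intro AE_I2) (auto simp: indicator_def)
  qed
  then have "AE x in ?M. g x * indicator P x = 0"
    using P0 by (subst (asm) integral_nonneg_eq_0_iff_AE) (auto simp: P_def indicator_def)
  then show ?thesis
  proof (rule AE_mp, intro AE_I2 impI)
    fix x assume "x \<in> space ?M" "g x * indicator P x = 0"
    then show "g x \<le> 0" by (auto simp: P_def space_restrict_space indicator_def split: if_splits)
  qed
qed

lemma zero_AE_if_orthogonal_test_fun:
  fixes \<Omega> :: "'a::euclidean_space set"
  assumes "open \<Omega>" "integrable (lebesgue_on \<Omega>) g"
    and "\<And>\<phi>. test_fun \<Omega> \<phi> \<Longrightarrow> (LINT x|lebesgue_on \<Omega>. g x * \<phi> x) = 0"
  shows "AE x in lebesgue_on \<Omega>. g x = 0"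
proof -
  have "AE x in lebesgue_on \<Omega>. g x \<le> 0"
    by (rule nonpos_AE_if_orthogonal_test_fun) (use assms in auto)
  moreover have "AE x in lebesgue_on \<Omega>. - g x \<le> 0"
    by (rule nonpos_AE_if_orthogonal_test_fun) (use assms in auto)
  ultimately show ?thesis by (rule AE_mp[OF AE_conjI]) simp
qed

text \<open>
  Translation invariance: the difference quotients of \<open>F\<close> in direction \<open>i\<close> integrate to \<open>0\<close>, and they
  converge to the partial derivative, dominated by a Lipschitz constant on a ball.
\<close>

lemma integral_partial_eq_0:
  fixes F :: "'a::euclidean_space \<Rightarrow> real"
  assumes F: "test_fun UNIV F" and i: "i \<in> Basis"
  shows "(LINT x|lborel. frechet_derivative F (at x) i) = 0"
proof -
  obtain K where K: "compact K" "\<And>x. F x \<noteq> 0 \<Longrightarrow> x \<in> K"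
    using F by (rule test_fun_support) blast
  obtain R where R: "R > 0" "K \<subseteq> ball 0 R"
    using bounded_subset_ballD[OF compact_imp_bounded[OF K(1)]] by blast
  obtain L where L: "\<And>x. \<bar>frechet_derivative F (at x) i\<bar> \<le> L"
    using test_fun_partial[OF F i] by (rule test_fun_bounded) blast
  have [measurable]: "F \<in> borel_measurable borel"
    using smooth_fun_continuous[OF test_fun_smooth[OF F]] by (rule borel_measurable_continuous_onI)
  have [measurable]: "(\<lambda>x. frechet_derivative F (at x) i) \<in> borel_measurable borel"
    using smooth_fun_continuous[OF test_fun_smooth[OF test_fun_partial[OF F i]]]
    by (rule borel_measurable_continuous_onI)
  obtain B where B: "\<And>x. \<bar>F x\<bar> \<le> B" using F by (rule test_fun_bounded) blast
  have intball: "integrable lborel (\<lambda>x. C * indicator (ball 0 (R + 1)) x :: real)" for C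
    by (intro integrable_mult_right integrable_real_indicator) (use emeasure_lborel_ball_finite in auto)
  have Fint: "integrable lborel F"
  proof (rule Bochner_Integration.integrable_bound[OF intball[of B]])
    show "AE x in lborel. norm (F x) \<le> norm (B * indicator (ball 0 (R + 1)) x)"
    proof (intro AE_I2)
      fix x
      show "norm (F x) \<le> norm (B * indicator (ball 0 (R + 1)) x)"
        using K(2)[of x] R B[of x] by (cases "F x = 0") (auto simp: indicator_def)
    qed
  qed simp
  have deriv: "((\<lambda>s. F (x + s *\<^sub>R i)) has_real_derivative frechet_derivative F (at (x + s *\<^sub>R i)) i) (at s)"
    for x s
  proof -
    have "((\<lambda>s. F (x + s *\<^sub>R i)) has_derivative (\<lambda>t. frechet_derivative F (at (x + s *\<^sub>R i)) (t *\<^sub>R i))) (at s)"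
      by (rule has_derivative_compose[of "\<lambda>s. x + s *\<^sub>R i" "\<lambda>t. t *\<^sub>R i" _ _ F])
        (auto intro!: derivative_eq_intros smooth_fun_has_derivative test_fun_smooth[OF F])
    moreover have "linear (frechet_derivative F (at (x + s *\<^sub>R i)))"
      using smooth_fun_differentiable[OF test_fun_smooth[OF F]] by (rule linear_frechet_derivative)
    ultimately show ?thesis
      by (simp add: has_field_derivative_def linear_cmul mult.commute[of _ "frechet_derivative F _ _"])
  qed
  define h where "h n = inverse (real (Suc n))" for n
  have h: "0 < h n" "h n \<le> 1" for n by (auto simp: h_def field_simps)
  have h0: "h \<longlonglongrightarrow> 0" unfolding h_def by (rule LIMSEQ_inverse_real_of_nat)
  define Q where "Q n x = (F (x + h n *\<^sub>R i) - F x) / h n" for n x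
  have [measurable]: "Q n \<in> borel_measurable borel" for n unfolding Q_def by measurable
  have Q0: "(LINT x|lborel. Q n x) = 0" for n
  proof -
    have eq: "(LINT x|lborel. F (h n *\<^sub>R i + x)) = (LINT x|lborel. F x)"
      using integral_distr[of "(+) (h n *\<^sub>R i)" lborel borel F] lborel_distr_plus[of "h n *\<^sub>R i"]
      by simp
    have "integrable (distr lborel borel ((+) (h n *\<^sub>R i))) F"
      using Fint by (simp add: lborel_distr_plus)
    then have "integrable lborel (\<lambda>x. F (h n *\<^sub>R i + x))"
      by (subst (asm) integrable_distr_eq) auto
    with eq Fint show ?thesis by (simp add: Q_def add.commute)
  qed
  have "(\<lambda>n. LINT x|lborel. Q n x) \<longlonglongrightarrow> (LINT x|lborel. frechet_derivative F (at x) i)"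
  proof (rule integral_dominated_convergence[OF _ _ intball[of L]])
    show "AE x in lborel. (\<lambda>n. Q n x) \<longlonglongrightarrow> frechet_derivative F (at x) i"
    proof (intro AE_I2)
      fix x
      have "((\<lambda>t. (F (x + t *\<^sub>R i) - F x) / t) \<longlongrightarrow> frechet_derivative F (at x) i) (at 0)"
        using deriv[of x 0] by (simp add: DERIV_def)
      then show "(\<lambda>n. Q n x) \<longlonglongrightarrow> frechet_derivative F (at x) i"
        unfolding Q_def
        by (rule filterlim_compose) (use h h0 in \<open>auto simp: filterlim_at less_imp_neq[symmetric] intro!: always_eventually\<close>)
    qed
    show "AE x in lborel. norm (Q n x) \<le> L * indicator (ball 0 (R + 1)) x" for n
    proof (intro AE_I2)
      fix x
      show "norm (Q n x) \<le> L * indicator (ball 0 (R + 1)) x"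
      proof (cases "x \<in> ball 0 (R + 1)")
        case True
        obtain z where "F (x + h n *\<^sub>R i) - F (x + 0 *\<^sub>R i)
            = (h n - 0) * frechet_derivative F (at (x + z *\<^sub>R i)) i"
          using MVT2[OF h(1)[of n] deriv[of x]] by blast
        then have "Q n x = frechet_derivative F (at (x + z *\<^sub>R i)) i"
          using h(1)[of n] by (simp add: Q_def)
        then show ?thesis using L True by simp
      next
        case False
        then have "R + 1 \<le> norm x" by simp
        moreover have "norm (h n *\<^sub>R i) \<le> 1" using h[of n] i by simp
        ultimately have "R \<le> norm (x + h n *\<^sub>R i)"
          using norm_triangle_ineq4[of "x + h n *\<^sub>R i" "h n *\<^sub>R i"] by simp
        moreover have "F y = 0" if "R \<le> norm y" for y
          using K(2)[of y] R that by (cases "F y = 0") (auto simp: subset_eq)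
        ultimately show ?thesis using \<open>R + 1 \<le> norm x\<close> by (simp add: Q_def)
      qed
    qed
  qed auto
  then show ?thesis by (simp add: Q0 LIMSEQ_const_iff)
qed

lemma test_fun_integral_by_parts:
  fixes \<Omega> :: "'a::euclidean_space set"
  assumes "open \<Omega>" and \<phi>: "test_fun \<Omega> \<phi>" and \<psi>: "test_fun \<Omega> \<psi>" and i: "i \<in> Basis"
    and fin: "\<Omega> \<in> lmeasurable"
  shows "L2_inner \<Omega> \<phi> (\<lambda>x. frechet_derivative \<psi> (at x) i)
      = - L2_inner \<Omega> (\<lambda>x. frechet_derivative \<phi> (at x) i) \<psi>"
proof -
  let ?d = "\<lambda>f x. frechet_derivative f (at x) i"
  let ?F = "\<lambda>x. \<phi> x * \<psi> x"
  have F: "test_fun \<Omega> ?F" by (rule test_fun_mult[OF \<psi> test_fun_smooth[OF \<phi>]])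
  obtain K where K: "compact K" "K \<subseteq> \<Omega>" "\<And>x. ?F x \<noteq> 0 \<Longrightarrow> x \<in> K"
    using F by (rule test_fun_support) blast
  have prod: "?d ?F x = \<phi> x * ?d \<psi> x + ?d \<phi> x * \<psi> x" for x
    by (rule partial_eqI)
      (intro has_derivative_mult smooth_fun_has_derivative test_fun_smooth[OF \<phi>] test_fun_smooth[OF \<psi>])
  have meas: "?d ?F \<in> borel_measurable borel"
    using smooth_fun_continuous[OF test_fun_smooth[OF test_fun_partial[OF F i]]]
    by (rule borel_measurable_continuous_onI)
  have "(LINT x|lebesgue_on \<Omega>. ?d ?F x) = (LINT x|lebesgue. indicator \<Omega> x *\<^sub>R ?d ?F x)"
    using assms(1) by (intro integral_restrict_space) auto
  also have "\<dots> = (LINT x|lebesgue. ?d ?F x)"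
  proof (rule Bochner_Integration.integral_cong)
    fix x show "indicator \<Omega> x *\<^sub>R ?d ?F x = ?d ?F x"
      using frechet_derivative_zero_off_support[OF K(1), of ?F x i] K(3) K(2) by (auto simp: indicator_def)
  qed simp
  also have "\<dots> = (LINT x|lborel. ?d ?F x)"
    by (rule integral_completion) (use meas in simp)
  also have "\<dots> = 0"
    by (rule integral_partial_eq_0[OF test_fun_mono[OF F] i]) simp
  finally have "(LINT x|lebesgue_on \<Omega>. \<phi> x * ?d \<psi> x + ?d \<phi> x * \<psi> x) = 0" by (simp add: prod)
  moreover have "integrable (lebesgue_on \<Omega>) (\<lambda>x. \<phi> x * ?d \<psi> x)"
    "integrable (lebesgue_on \<Omega>) (\<lambda>x. ?d \<phi> x * \<psi> x)"
    by (intro L2_mult_integrable test_fun_L2 fin \<phi> \<psi> test_fun_partial i)+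
  ultimately show ?thesis by (simp add: L2_inner_def)
qed

section \<open>Weak derivatives and the Dirichlet Laplacian\<close>

lemma L2_tendsto_scale:
  assumes "L2_tendsto \<Omega> f u F"
  shows "L2_tendsto \<Omega> (\<lambda>s x. c * f s x) (\<lambda>x. c * u x) F"
  unfolding L2_tendsto_def
proof (intro conjI)
  show "(\<lambda>x. c * u x) \<in> L2_space \<Omega>" using assms by (auto simp: L2_tendsto_def intro: L2_scale)
  have "\<forall>\<^sub>F s in F. f s \<in> L2_space \<Omega>" using assms by (simp add: L2_tendsto_def)
  then show "\<forall>\<^sub>F s in F. (\<lambda>x. c * f s x) \<in> L2_space \<Omega>"
    by eventually_elim (rule L2_scale)
  have "((\<lambda>s. \<bar>c\<bar> * L2_norm \<Omega> (\<lambda>x. f s x - u x)) \<longlongrightarrow> \<bar>c\<bar> * 0) F"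
    using assms by (intro tendsto_intros) (simp add: L2_tendsto_def)
  then show "((\<lambda>s. L2_norm \<Omega> (\<lambda>x. c * f s x - c * u x)) \<longlongrightarrow> 0) F"
    by (simp add: L2_norm_scale flip: right_diff_distrib)
qed

lemma L2_tendsto_add:
  assumes f: "L2_tendsto \<Omega> f u F" and g: "L2_tendsto \<Omega> g v F"
  shows "L2_tendsto \<Omega> (\<lambda>s x. f s x + g s x) (\<lambda>x. u x + v x) F"
  unfolding L2_tendsto_def
proof (intro conjI)
  have u: "u \<in> L2_space \<Omega>" and v: "v \<in> L2_space \<Omega>" using f g by (auto simp: L2_tendsto_def)
  then show "(\<lambda>x. u x + v x) \<in> L2_space \<Omega>" by (rule L2_add)
  have ev: "\<forall>\<^sub>F s in F. f s \<in> L2_space \<Omega> \<and> g s \<in> L2_space \<Omega>"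
    using f g by (auto simp: L2_tendsto_def eventually_conj_iff)
  then show "\<forall>\<^sub>F s in F. (\<lambda>x. f s x + g s x) \<in> L2_space \<Omega>"
    by eventually_elim (auto intro: L2_add)
  have lim: "((\<lambda>s. L2_norm \<Omega> (\<lambda>x. f s x - u x) + L2_norm \<Omega> (\<lambda>x. g s x - v x)) \<longlongrightarrow> 0 + 0) F"
    using f g by (intro tendsto_intros) (auto simp: L2_tendsto_def)
  show "((\<lambda>s. L2_norm \<Omega> (\<lambda>x. f s x + g s x - (u x + v x))) \<longlongrightarrow> 0) F"
  proof (rule Lim_null_comparison)
    show "\<forall>\<^sub>F s in F. norm (L2_norm \<Omega> (\<lambda>x. f s x + g s x - (u x + v x)))
        \<le> L2_norm \<Omega> (\<lambda>x. f s x - u x) + L2_norm \<Omega> (\<lambda>x. g s x - v x)"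
      using ev
    proof eventually_elim
      case (elim s)
      then show ?case
        using L2_norm_triangle[OF L2_diff[of "f s" \<Omega> u] L2_diff[of "g s" \<Omega> v]] u v
        by (simp add: algebra_simps)
    qed
  qed (use lim in simp)
qed

lemma L2_tendsto_cong_limit:
  assumes "L2_tendsto \<Omega> f u F" "L2_eq \<Omega> u v" "v \<in> L2_space \<Omega>"
  shows "L2_tendsto \<Omega> f v F"
proof -
  have u: "u \<in> L2_space \<Omega>" and ev: "\<forall>\<^sub>F s in F. f s \<in> L2_space \<Omega>"
    and lim: "((\<lambda>s. L2_norm \<Omega> (\<lambda>x. f s x - u x)) \<longlongrightarrow> 0) F"
    using assms(1) by (auto simp: L2_tendsto_def)
  have "((\<lambda>s. L2_norm \<Omega> (\<lambda>x. f s x - v x)) \<longlongrightarrow> 0) F"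
  proof (rule Lim_transform_eventually[OF lim])
    show "\<forall>\<^sub>F s in F. L2_norm \<Omega> (\<lambda>x. f s x - u x) = L2_norm \<Omega> (\<lambda>x. f s x - v x)"
      using ev
    proof eventually_elim
      case (elim s)
      have "L2_eq \<Omega> (\<lambda>x. f s x - u x) (\<lambda>x. f s x - v x)"
        using assms(2) unfolding L2_eq_def by (rule AE_mp) simp
      then show ?case using elim u assms(3) by (intro L2_norm_cong L2_diff)
    qed
  qed
  with ev assms(3) show ?thesis by (simp add: L2_tendsto_def)
qed

locale finite_open_set =
  fixes \<Omega> :: "'a::euclidean_space set"
  assumes open_\<Omega>: "open \<Omega>" and lmeasurable_\<Omega>: "\<Omega> \<in> lmeasurable"
begin

lemma L2_eq_zero_if_orthogonal_test_fun:
  assumes "g \<in> L2_space \<Omega>" "\<And>\<phi>. test_fun \<Omega> \<phi> \<Longrightarrow> L2_inner \<Omega> g \<phi> = 0"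
  shows "L2_eq \<Omega> g (\<lambda>x. 0)"
  unfolding L2_eq_def
  by (rule zero_AE_if_orthogonal_test_fun[OF open_\<Omega>])
    (use L2_mult_integrable[OF assms(1) constant_one_L2[OF lmeasurable_\<Omega>]] assms(2) in \<open>auto simp: L2_inner_def\<close>)

lemmas test_L2 = test_fun_L2[OF lmeasurable_\<Omega>]
lemmas test_partial_L2 = test_fun_L2[OF lmeasurable_\<Omega> test_fun_partial]

text \<open>
  Since \<open>weak_deriv\<close> selects an arbitrary weak derivative, uniqueness is what makes it linear and
  compatible with \<open>L2_eq\<close>, and with it the domain and the action of the Laplacian.
\<close>

lemma has_weak_deriv_unique:
  assumes "has_weak_deriv \<Omega> i u g" "has_weak_deriv \<Omega> i u h"
  shows "L2_eq \<Omega> g h"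
proof -
  have L2: "g \<in> L2_space \<Omega>" "h \<in> L2_space \<Omega>" using assms by (auto simp: has_weak_deriv_def)
  have "L2_eq \<Omega> (\<lambda>x. g x - h x) (\<lambda>x. 0)"
  proof (rule L2_eq_zero_if_orthogonal_test_fun)
    fix \<phi> assume "test_fun \<Omega> \<phi>"
    then show "L2_inner \<Omega> (\<lambda>x. g x - h x) \<phi> = 0"
      using assms by (auto simp: has_weak_deriv_def L2_inner_diff_left L2 test_L2)
  qed (intro L2_diff L2)
  then show ?thesis by (simp add: L2_eq_diff_zero_iff)
qed

lemma has_weak_deriv_lincomb:
  assumes "u \<in> L2_space \<Omega>" "v \<in> L2_space \<Omega>" "i \<in> Basis"
    and "has_weak_deriv \<Omega> i u g" "has_weak_deriv \<Omega> i v h"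
  shows "has_weak_deriv \<Omega> i (\<lambda>x. a * u x + b * v x) (\<lambda>x. a * g x + b * h x)"
proof -
  have L2: "g \<in> L2_space \<Omega>" "h \<in> L2_space \<Omega>" using assms by (auto simp: has_weak_deriv_def)
  show ?thesis
    unfolding has_weak_deriv_def
  proof (intro conjI allI impI)
    fix \<phi> assume \<phi>: "test_fun \<Omega> \<phi>"
    have "L2_inner \<Omega> u (\<lambda>x. frechet_derivative \<phi> (at x) i) = - L2_inner \<Omega> g \<phi>"
      "L2_inner \<Omega> v (\<lambda>x. frechet_derivative \<phi> (at x) i) = - L2_inner \<Omega> h \<phi>"
      using assms(4,5) \<phi> by (auto simp: has_weak_deriv_def)
    then show "L2_inner \<Omega> (\<lambda>x. a * u x + b * v x) (\<lambda>x. frechet_derivative \<phi> (at x) i)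
        = - L2_inner \<Omega> (\<lambda>x. a * g x + b * h x) \<phi>"
      by (simp add: L2_inner_add_left L2_inner_scale_left L2_scale assms(1,2) L2 test_L2[OF \<phi>]
          test_partial_L2[OF \<phi> assms(3)])
  qed (intro L2_add L2_scale L2)
qed

lemma has_weak_deriv_cong:
  assumes "has_weak_deriv \<Omega> i u g" "L2_eq \<Omega> u v" "u \<in> L2_space \<Omega>" "v \<in> L2_space \<Omega>" "i \<in> Basis"
  shows "has_weak_deriv \<Omega> i v g"
  using assms(1) L2_inner_cong[OF assms(2-4) test_partial_L2[OF _ assms(5)]]
  by (auto simp: has_weak_deriv_def)

lemma test_fun_has_weak_deriv:
  assumes "test_fun \<Omega> \<phi>" "i \<in> Basis"
  shows "has_weak_deriv \<Omega> i \<phi> (\<lambda>x. frechet_derivative \<phi> (at x) i)"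
  unfolding has_weak_deriv_def
  using test_partial_L2[OF assms] test_fun_integral_by_parts[OF open_\<Omega> assms(1) _ assms(2) lmeasurable_\<Omega>]
  by auto

lemma H1_L2: "u \<in> H1_space \<Omega> \<Longrightarrow> u \<in> L2_space \<Omega>"
  by (simp add: H1_space_def)

lemma weak_deriv_works:
  assumes "u \<in> H1_space \<Omega>" "i \<in> Basis"
  shows "has_weak_deriv \<Omega> i u (weak_deriv \<Omega> i u)"
proof -
  have "\<exists>g. has_weak_deriv \<Omega> i u g" using assms by (simp add: H1_space_def)
  then show ?thesis unfolding weak_deriv_def by (rule someI_ex)
qed

lemma weak_deriv_L2:
  "u \<in> H1_space \<Omega> \<Longrightarrow> i \<in> Basis \<Longrightarrow> weak_deriv \<Omega> i u \<in> L2_space \<Omega>"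
  using weak_deriv_works by (auto simp: has_weak_deriv_def)

lemma weak_deriv_eqI:
  assumes "has_weak_deriv \<Omega> i u g"
  shows "L2_eq \<Omega> (weak_deriv \<Omega> i u) g"
  using has_weak_deriv_unique[OF _ assms] someI[of "has_weak_deriv \<Omega> i u", OF assms]
  by (simp add: weak_deriv_def)

lemma test_fun_H1: "test_fun \<Omega> \<phi> \<Longrightarrow> \<phi> \<in> H1_space \<Omega>"
  using test_L2 test_fun_has_weak_deriv by (fastforce simp: H1_space_def)

lemma H1_lincomb:
  assumes "u \<in> H1_space \<Omega>" "v \<in> H1_space \<Omega>"
  shows "(\<lambda>x. a * u x + b * v x) \<in> H1_space \<Omega>"
  unfolding H1_space_def
  using has_weak_deriv_lincomb[OF H1_L2[OF assms(1)] H1_L2[OF assms(2)] _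
      weak_deriv_works[OF assms(1)] weak_deriv_works[OF assms(2)]]
    H1_L2[OF assms(1)] H1_L2[OF assms(2)]
  by (auto intro!: L2_add L2_scale)

lemma weak_deriv_lincomb:
  assumes "u \<in> H1_space \<Omega>" "v \<in> H1_space \<Omega>" "i \<in> Basis"
  shows "L2_eq \<Omega> (weak_deriv \<Omega> i (\<lambda>x. a * u x + b * v x))
    (\<lambda>x. a * weak_deriv \<Omega> i u x + b * weak_deriv \<Omega> i v x)"
  by (intro weak_deriv_eqI has_weak_deriv_lincomb weak_deriv_works H1_L2 assms)

lemma H1_cong:
  assumes "u \<in> H1_space \<Omega>" "L2_eq \<Omega> u v" "v \<in> L2_space \<Omega>"
  shows "v \<in> H1_space \<Omega>"
  using assms has_weak_deriv_cong[OF weak_deriv_works[OF assms(1)] assms(2) H1_L2[OF assms(1)] assms(3)]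
  by (auto simp: H1_space_def)

lemma weak_deriv_cong:
  assumes "u \<in> H1_space \<Omega>" "L2_eq \<Omega> u v" "v \<in> L2_space \<Omega>" "i \<in> Basis"
  shows "L2_eq \<Omega> (weak_deriv \<Omega> i v) (weak_deriv \<Omega> i u)"
  by (intro weak_deriv_eqI has_weak_deriv_cong[OF weak_deriv_works[OF assms(1)] assms(2)] H1_L2 assms)

lemma H2_H1: "u \<in> H2_space \<Omega> \<Longrightarrow> u \<in> H1_space \<Omega>"
  by (simp add: H2_space_def)

lemma H2_weak_deriv: "u \<in> H2_space \<Omega> \<Longrightarrow> i \<in> Basis \<Longrightarrow> weak_deriv \<Omega> i u \<in> H1_space \<Omega>"
  by (simp add: H2_space_def)

lemma H2_lincomb:
  assumes "u \<in> H2_space \<Omega>" "v \<in> H2_space \<Omega>"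
  shows "(\<lambda>x. a * u x + b * v x) \<in> H2_space \<Omega>"
proof -
  let ?w = "\<lambda>x. a * u x + b * v x"
  have H1: "?w \<in> H1_space \<Omega>" by (intro H1_lincomb H2_H1 assms)
  have "weak_deriv \<Omega> i ?w \<in> H1_space \<Omega>" if "i \<in> Basis" for i
    by (rule H1_cong[OF H1_lincomb[OF H2_weak_deriv[OF assms(1) that] H2_weak_deriv[OF assms(2) that]]
          L2_eq_sym[OF weak_deriv_lincomb[OF H2_H1[OF assms(1)] H2_H1[OF assms(2)] that]]
          weak_deriv_L2[OF H1 that]])
  with H1 show ?thesis by (simp add: H2_space_def)
qed

lemma dirichlet_op_lincomb:
  assumes "u \<in> H2_space \<Omega>" "v \<in> H2_space \<Omega>"
  shows "L2_eq \<Omega> (dirichlet_op \<Omega> (\<lambda>x. a * u x + b * v x))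
    (\<lambda>x. a * dirichlet_op \<Omega> u x + b * dirichlet_op \<Omega> v x)"
proof -
  let ?w = "\<lambda>x. a * u x + b * v x"
  let ?dd = "\<lambda>i f. weak_deriv \<Omega> i (weak_deriv \<Omega> i f)"
  have *: "AE x in lebesgue_on \<Omega>. ?dd i ?w x = a * ?dd i u x + b * ?dd i v x" if i: "i \<in> Basis" for i
  proof -
    note wu = H2_weak_deriv[OF assms(1) i] and wv = H2_weak_deriv[OF assms(2) i]
    have "?w \<in> H1_space \<Omega>" by (intro H1_lincomb H2_H1 assms)
    then have "L2_eq \<Omega> (?dd i ?w)
        (weak_deriv \<Omega> i (\<lambda>x. a * weak_deriv \<Omega> i u x + b * weak_deriv \<Omega> i v x))"
      by (rule weak_deriv_cong[OF H1_lincomb[OF wu wv]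
          L2_eq_sym[OF weak_deriv_lincomb[OF H2_H1[OF assms(1)] H2_H1[OF assms(2)] i]]
          weak_deriv_L2[OF _ i] i])
    from L2_eq_trans[OF this weak_deriv_lincomb[OF wu wv i]] show ?thesis
      by (simp add: L2_eq_def)
  qed
  have "AE x in lebesgue_on \<Omega>. \<forall>i\<in>Basis. ?dd i ?w x = a * ?dd i u x + b * ?dd i v x"
    by (rule AE_finite_allI[OF finite_Basis *])
  then show ?thesis
    unfolding L2_eq_def dirichlet_op_def
    by (rule AE_mp) (auto simp: sum.distrib sum_distrib_left)
qed

lemma H1_norm_diff_test_fun:
  assumes "u \<in> H1_space \<Omega>" "test_fun \<Omega> \<phi>"
  shows "(H1_norm \<Omega> (\<lambda>x. u x - \<phi> x))\<^sup>2 = (L2_norm \<Omega> (\<lambda>x. u x - \<phi> x))\<^sup>2 +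
    (\<Sum>i\<in>Basis. (L2_norm \<Omega> (\<lambda>x. weak_deriv \<Omega> i u x - frechet_derivative \<phi> (at x) i))\<^sup>2)"
proof -
  have "L2_norm \<Omega> (weak_deriv \<Omega> i (\<lambda>x. u x - \<phi> x))
      = L2_norm \<Omega> (\<lambda>x. weak_deriv \<Omega> i u x - frechet_derivative \<phi> (at x) i)" if i: "i \<in> Basis" for i
  proof (rule L2_norm_cong)
    show "L2_eq \<Omega> (weak_deriv \<Omega> i (\<lambda>x. u x - \<phi> x))
        (\<lambda>x. weak_deriv \<Omega> i u x - frechet_derivative \<phi> (at x) i)"
      using weak_deriv_eqI[OF has_weak_deriv_lincomb[OF H1_L2[OF assms(1)] test_L2[OF assms(2)] i
          weak_deriv_works[OF assms(1) i] test_fun_has_weak_deriv[OF assms(2) i], of 1 "-1"]]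
      by simp
    have "(\<lambda>x. u x - \<phi> x) \<in> H1_space \<Omega>"
      using H1_lincomb[OF assms(1) test_fun_H1[OF assms(2)], of 1 "-1"] by simp
    then show "weak_deriv \<Omega> i (\<lambda>x. u x - \<phi> x) \<in> L2_space \<Omega>" using i by (rule weak_deriv_L2)
  qed (intro L2_diff weak_deriv_L2 test_partial_L2 assms i)
  then show ?thesis
    unfolding H1_norm_def by (simp add: sum_nonneg)
qed

text \<open>
  Membership in \<open>H\<^sup>1\<^sub>0\<close> as existence of one sequence of test functions converging together with its
  partial derivatives; this form is linear and passes to inner products directly.
\<close>

definition H10_approx :: "(nat \<Rightarrow> 'a \<Rightarrow> real) \<Rightarrow> ('a \<Rightarrow> real) \<Rightarrow> bool" where
  "H10_approx \<phi> u \<longleftrightarrow> (\<forall>n. test_fun \<Omega> (\<phi> n)) \<and> L2_tendsto \<Omega> \<phi> u sequentially \<and>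
     (\<forall>i\<in>Basis. L2_tendsto \<Omega> (\<lambda>n x. frechet_derivative (\<phi> n) (at x) i) (weak_deriv \<Omega> i u) sequentially)"

lemma H10_iff_approx:
  "u \<in> H10_space \<Omega> \<longleftrightarrow> u \<in> H1_space \<Omega> \<and> (\<exists>\<phi>. H10_approx \<phi> u)"
proof (intro iffI conjI)
  assume u: "u \<in> H10_space \<Omega>"
  then show H1: "u \<in> H1_space \<Omega>" by (simp add: H10_space_def)
  have "\<exists>\<phi>. test_fun \<Omega> \<phi> \<and> H1_norm \<Omega> (\<lambda>x. u x - \<phi> x) < inverse (real (Suc n))" for n
    using u by (simp add: H10_space_def)
  then obtain \<phi> where \<phi>: "\<And>n. test_fun \<Omega> (\<phi> n)"
    "\<And>n. H1_norm \<Omega> (\<lambda>x. u x - \<phi> n x) < inverse (real (Suc n))" by metis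
  have nn: "0 \<le> H1_norm \<Omega> w" for w by (simp add: H1_norm_def sum_nonneg)
  have small: "f \<longlonglongrightarrow> 0" if "\<And>n. 0 \<le> f n" "\<And>n. (f n)\<^sup>2 \<le> (H1_norm \<Omega> (\<lambda>x. u x - \<phi> n x))\<^sup>2" for f
  proof (rule tendsto_sandwich[OF _ _ tendsto_const LIMSEQ_inverse_real_of_nat])
    have "f n \<le> H1_norm \<Omega> (\<lambda>x. u x - \<phi> n x)" for n
      using that(2) nn by (rule power2_le_imp_le)
    then show "\<forall>\<^sub>F n in sequentially. f n \<le> inverse (real (Suc n))"
      using \<phi>(2) by (intro always_eventually allI) (meson less_imp_le order_trans)
  qed (use that in auto)
  have "(\<lambda>n. L2_norm \<Omega> (\<lambda>x. u x - \<phi> n x)) \<longlonglongrightarrow> 0"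
    by (rule small) (auto simp: H1_norm_diff_test_fun[OF H1 \<phi>(1)] sum_nonneg)
  then have 1: "L2_tendsto \<Omega> \<phi> u sequentially"
    using H1_L2[OF H1] test_L2[OF \<phi>(1)] by (simp add: L2_tendsto_def L2_norm_minus_commute[of _ _ u])
  have 2: "L2_tendsto \<Omega> (\<lambda>n x. frechet_derivative (\<phi> n) (at x) i) (weak_deriv \<Omega> i u) sequentially"
    if i: "i \<in> Basis" for i
  proof -
    have "(\<lambda>n. L2_norm \<Omega> (\<lambda>x. weak_deriv \<Omega> i u x - frechet_derivative (\<phi> n) (at x) i)) \<longlonglongrightarrow> 0"
    proof (rule small)
      fix n
      have "(L2_norm \<Omega> (\<lambda>x. weak_deriv \<Omega> i u x - frechet_derivative (\<phi> n) (at x) i))\<^sup>2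
        \<le> (\<Sum>i\<in>Basis. (L2_norm \<Omega> (\<lambda>x. weak_deriv \<Omega> i u x - frechet_derivative (\<phi> n) (at x) i))\<^sup>2)"
        using i by (intro member_le_sum) auto
      also have "\<dots> \<le> (H1_norm \<Omega> (\<lambda>x. u x - \<phi> n x))\<^sup>2"
        by (simp add: H1_norm_diff_test_fun[OF H1 \<phi>(1)])
      finally show "(L2_norm \<Omega> (\<lambda>x. weak_deriv \<Omega> i u x - frechet_derivative (\<phi> n) (at x) i))\<^sup>2
        \<le> (H1_norm \<Omega> (\<lambda>x. u x - \<phi> n x))\<^sup>2" .
    qed simp
    then show ?thesis
      using weak_deriv_L2[OF H1 i] test_partial_L2[OF \<phi>(1) i]
      by (simp add: L2_tendsto_def L2_norm_minus_commute[of _ _ "weak_deriv \<Omega> i u"])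
  qed
  show "\<exists>\<phi>. H10_approx \<phi> u" using \<phi>(1) 1 2 unfolding H10_approx_def by blast
next
  assume "u \<in> H1_space \<Omega> \<and> (\<exists>\<phi>. H10_approx \<phi> u)"
  then obtain \<phi> where H1: "u \<in> H1_space \<Omega>" and approx: "H10_approx \<phi> u" by blast
  then have \<phi>: "test_fun \<Omega> (\<phi> n)" for n by (simp add: H10_approx_def)
  have L: "(\<lambda>n. L2_norm \<Omega> (\<lambda>x. u x - \<phi> n x)) \<longlonglongrightarrow> 0"
    unfolding L2_norm_minus_commute[of \<Omega> u] using approx by (simp add: H10_approx_def L2_tendsto_def)
  have L': "(\<lambda>n. L2_norm \<Omega> (\<lambda>x. weak_deriv \<Omega> i u x - frechet_derivative (\<phi> n) (at x) i)) \<longlonglongrightarrow> 0"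
    if "i \<in> Basis" for i
    unfolding L2_norm_minus_commute[of \<Omega> "weak_deriv \<Omega> i u"]
    using approx that by (simp add: H10_approx_def L2_tendsto_def)
  have "(\<lambda>n. sqrt ((L2_norm \<Omega> (\<lambda>x. u x - \<phi> n x))\<^sup>2 +
      (\<Sum>i\<in>Basis. (L2_norm \<Omega> (\<lambda>x. weak_deriv \<Omega> i u x - frechet_derivative (\<phi> n) (at x) i))\<^sup>2)))
    \<longlonglongrightarrow> sqrt (0\<^sup>2 + (\<Sum>i\<in>(Basis::'a set). 0\<^sup>2))"
    by (intro tendsto_intros L L')
  moreover have "sqrt ((L2_norm \<Omega> (\<lambda>x. u x - \<phi> n x))\<^sup>2 +
      (\<Sum>i\<in>Basis. (L2_norm \<Omega> (\<lambda>x. weak_deriv \<Omega> i u x - frechet_derivative (\<phi> n) (at x) i))\<^sup>2))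
      = H1_norm \<Omega> (\<lambda>x. u x - \<phi> n x)" for n
    unfolding H1_norm_diff_test_fun[OF H1 \<phi>, symmetric] by (simp add: H1_norm_def sum_nonneg)
  ultimately have "(\<lambda>n. H1_norm \<Omega> (\<lambda>x. u x - \<phi> n x)) \<longlonglongrightarrow> 0" by simp
  then have lim: "\<forall>\<^sub>F n in sequentially. H1_norm \<Omega> (\<lambda>x. u x - \<phi> n x) < \<epsilon>" if "\<epsilon> > 0" for \<epsilon>
    using order_tendstoD(2)[OF _ that] by blast
  have "\<exists>\<psi>. test_fun \<Omega> \<psi> \<and> H1_norm \<Omega> (\<lambda>x. u x - \<psi> x) < \<epsilon>" if \<epsilon>: "\<epsilon> > 0" for \<epsilon>
  proof -
    obtain n where "H1_norm \<Omega> (\<lambda>x. u x - \<phi> n x) < \<epsilon>"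
      using eventually_happens'[OF sequentially_bot lim[OF \<epsilon>]] ..
    with \<phi>[of n] show ?thesis by (intro exI[of _ "\<phi> n"] conjI)
  qed
  with H1 show "u \<in> H10_space \<Omega>" by (simp add: H10_space_def)
qed

lemma H10_lincomb:
  assumes "u \<in> H10_space \<Omega>" "v \<in> H10_space \<Omega>"
  shows "(\<lambda>x. a * u x + b * v x) \<in> H10_space \<Omega>"
proof -
  obtain \<phi> \<psi> where \<phi>: "H10_approx \<phi> u" and \<psi>: "H10_approx \<psi> v"
    and H1: "u \<in> H1_space \<Omega>" "v \<in> H1_space \<Omega>"
    using assms by (auto simp: H10_iff_approx)
  let ?w = "\<lambda>x. a * u x + b * v x"
  let ?\<chi> = "\<lambda>n x. a * \<phi> n x + b * \<psi> n x"
  have t: "test_fun \<Omega> (\<phi> n)" "test_fun \<Omega> (\<psi> n)" for n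
    using \<phi> \<psi> by (auto simp: H10_approx_def)
  have w: "?w \<in> H1_space \<Omega>" by (intro H1_lincomb H1)
  have "test_fun \<Omega> (?\<chi> n)" for n
    using test_fun_add[OF test_fun_mult[OF t(1) smooth_fun_const] test_fun_mult[OF t(2) smooth_fun_const]] .
  moreover have "L2_tendsto \<Omega> ?\<chi> ?w sequentially"
    using \<phi> \<psi> by (intro L2_tendsto_add L2_tendsto_scale) (auto simp: H10_approx_def)
  moreover have "L2_tendsto \<Omega> (\<lambda>n x. frechet_derivative (?\<chi> n) (at x) i) (weak_deriv \<Omega> i ?w) sequentially"
    if i: "i \<in> Basis" for i
  proof (rule L2_tendsto_cong_limit)
    have "frechet_derivative (?\<chi> n) (at x) i
        = a * frechet_derivative (\<phi> n) (at x) i + b * frechet_derivative (\<psi> n) (at x) i" for n x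
      by (rule partial_eqI, intro has_derivative_add has_derivative_mult_right
          smooth_fun_has_derivative test_fun_smooth[OF t(1)] test_fun_smooth[OF t(2)])
    then show "L2_tendsto \<Omega> (\<lambda>n x. frechet_derivative (?\<chi> n) (at x) i)
        (\<lambda>x. a * weak_deriv \<Omega> i u x + b * weak_deriv \<Omega> i v x) sequentially"
      using \<phi> \<psi> i by (simp add: L2_tendsto_add L2_tendsto_scale H10_approx_def)
    show "L2_eq \<Omega> (\<lambda>x. a * weak_deriv \<Omega> i u x + b * weak_deriv \<Omega> i v x) (weak_deriv \<Omega> i ?w)"
      by (rule L2_eq_sym[OF weak_deriv_lincomb[OF H1 i]])
    show "weak_deriv \<Omega> i ?w \<in> L2_space \<Omega>" by (intro weak_deriv_L2 w i)
  qed
  ultimately have "H10_approx ?\<chi> ?w" by (simp add: H10_approx_def)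
  with w show ?thesis unfolding H10_iff_approx by blast
qed

lemma dirichlet_dom_lincomb:
  assumes "u \<in> dirichlet_dom \<Omega>" "v \<in> dirichlet_dom \<Omega>"
  shows "(\<lambda>x. a * u x + b * v x) \<in> dirichlet_dom \<Omega>"
  using assms H2_lincomb H10_lincomb by (simp add: dirichlet_dom_def)

lemma dirichlet_dom_L2: "u \<in> dirichlet_dom \<Omega> \<Longrightarrow> u \<in> L2_space \<Omega>"
  by (auto simp: dirichlet_dom_def dest: H2_H1 H1_L2)

lemma dirichlet_op_L2:
  assumes "u \<in> dirichlet_dom \<Omega>" shows "dirichlet_op \<Omega> u \<in> L2_space \<Omega>"
proof -
  have "u \<in> H2_space \<Omega>" using assms by (simp add: dirichlet_dom_def)
  then have "(\<lambda>x. (-1) * (\<Sum>i\<in>Basis. weak_deriv \<Omega> i (weak_deriv \<Omega> i u) x)) \<in> L2_space \<Omega>"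
    by (intro L2_scale L2_sum weak_deriv_L2 H2_weak_deriv)
  then show ?thesis by (simp add: dirichlet_op_def)
qed

text \<open>
  For a test function in place of \<open>v\<close> this is the definition of the weak derivative; the general case
  follows by approximation, which is where the boundary condition on \<open>v\<close> enters.
\<close>

lemma H10_integral_by_parts:
  assumes "g \<in> H1_space \<Omega>" "v \<in> H10_space \<Omega>" "i \<in> Basis"
  shows "L2_inner \<Omega> (weak_deriv \<Omega> i g) v = - L2_inner \<Omega> g (weak_deriv \<Omega> i v)"
proof -
  obtain \<phi> where \<phi>: "H10_approx \<phi> v" using assms(2) by (auto simp: H10_iff_approx)
  have "(\<lambda>n. L2_inner \<Omega> (\<phi> n) (weak_deriv \<Omega> i g)) \<longlonglongrightarrow> L2_inner \<Omega> v (weak_deriv \<Omega> i g)"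
    using \<phi> by (intro L2_tendsto_inner weak_deriv_L2 assms) (simp add: H10_approx_def)
  moreover have "L2_inner \<Omega> (\<phi> n) (weak_deriv \<Omega> i g)
      = - L2_inner \<Omega> (\<lambda>x. frechet_derivative (\<phi> n) (at x) i) g" for n
    using \<phi> weak_deriv_works[OF assms(1,3)]
    by (simp add: H10_approx_def has_weak_deriv_def L2_inner_commute)
  moreover have "(\<lambda>n. - L2_inner \<Omega> (\<lambda>x. frechet_derivative (\<phi> n) (at x) i) g)
      \<longlonglongrightarrow> - L2_inner \<Omega> (weak_deriv \<Omega> i v) g"
    using \<phi> assms by (intro tendsto_minus L2_tendsto_inner H1_L2) (auto simp: H10_approx_def)
  ultimately have "L2_inner \<Omega> v (weak_deriv \<Omega> i g) = - L2_inner \<Omega> (weak_deriv \<Omega> i v) g"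
    using LIMSEQ_unique by simp
  then show ?thesis by (simp add: L2_inner_commute)
qed

text \<open>
  The right-hand side is symmetric in \<open>u\<close> and \<open>v\<close>; from this follow the symmetry of the Laplacian and
  the orthogonality of eigenspaces.
\<close>

lemma dirichlet_form:
  assumes "u \<in> dirichlet_dom \<Omega>" "v \<in> dirichlet_dom \<Omega>"
  shows "L2_inner \<Omega> (dirichlet_op \<Omega> u) v
    = (\<Sum>i\<in>Basis. L2_inner \<Omega> (weak_deriv \<Omega> i u) (weak_deriv \<Omega> i v))"
proof -
  have u: "u \<in> H2_space \<Omega>" and v: "v \<in> H10_space \<Omega>" using assms by (auto simp: dirichlet_dom_def)
  have "L2_inner \<Omega> (\<lambda>x. (-1) * (\<Sum>i\<in>Basis. weak_deriv \<Omega> i (weak_deriv \<Omega> i u) x)) v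
      = - (\<Sum>i\<in>Basis. L2_inner \<Omega> (weak_deriv \<Omega> i (weak_deriv \<Omega> i u)) v)"
    by (subst L2_inner_scale_left, subst L2_inner_sum_left)
      (auto intro: weak_deriv_L2 H2_weak_deriv u dirichlet_dom_L2 assms)
  also have "\<dots> = (\<Sum>i\<in>Basis. L2_inner \<Omega> (weak_deriv \<Omega> i u) (weak_deriv \<Omega> i v))"
    by (simp add: H10_integral_by_parts[OF H2_weak_deriv[OF u] v] sum_negf)
  finally show ?thesis by (simp add: dirichlet_op_def)
qed

lemma dirichlet_op_symmetric:
  assumes "u \<in> dirichlet_dom \<Omega>" "v \<in> dirichlet_dom \<Omega>"
  shows "L2_inner \<Omega> (dirichlet_op \<Omega> u) v = L2_inner \<Omega> u (dirichlet_op \<Omega> v)"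
  using dirichlet_form[OF assms] dirichlet_form[OF assms(2,1)] by (simp add: L2_inner_commute)

lemma dirichlet_eigenspace_lincomb:
  assumes "u \<in> dirichlet_eigenspace \<Omega> \<nu>" "v \<in> dirichlet_eigenspace \<Omega> \<nu>"
  shows "(\<lambda>x. a * u x + b * v x) \<in> dirichlet_eigenspace \<Omega> \<nu>"
proof -
  have dom: "u \<in> dirichlet_dom \<Omega>" "v \<in> dirichlet_dom \<Omega>"
    and eq: "AE x in lebesgue_on \<Omega>. dirichlet_op \<Omega> u x - \<nu> * u x = 0"
      "AE x in lebesgue_on \<Omega>. dirichlet_op \<Omega> v x - \<nu> * v x = 0"
    using assms by (auto simp: dirichlet_eigenspace_def op_kernel_def op_shift_def L2_eq_def)
  have "AE x in lebesgue_on \<Omega>. dirichlet_op \<Omega> (\<lambda>x. a * u x + b * v x) x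
      = a * dirichlet_op \<Omega> u x + b * dirichlet_op \<Omega> v x"
    using dirichlet_op_lincomb[of u v a b] dom by (simp add: L2_eq_def dirichlet_dom_def)
  with eq have "AE x in lebesgue_on \<Omega>. dirichlet_op \<Omega> (\<lambda>x. a * u x + b * v x) x
      - \<nu> * (a * u x + b * v x) = 0"
  proof eventually_elim
    case (elim x)
    then have "dirichlet_op \<Omega> u x = \<nu> * u x" "dirichlet_op \<Omega> v x = \<nu> * v x" by auto
    with elim(3) show ?case by (simp add: algebra_simps)
  qed
  with dirichlet_dom_lincomb[OF dom] show ?thesis
    by (simp add: dirichlet_eigenspace_def op_kernel_def op_shift_def L2_eq_def)
qed

lemma dirichlet_eigenspace_orthogonal:
  assumes "u \<in> dirichlet_eigenspace \<Omega> \<mu>" "v \<in> dirichlet_eigenspace \<Omega> \<nu>" "\<mu> \<noteq> \<nu>"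
  shows "L2_inner \<Omega> u v = 0"
proof -
  have dom: "u \<in> dirichlet_dom \<Omega>" "v \<in> dirichlet_dom \<Omega>"
    and eq: "L2_eq \<Omega> (dirichlet_op \<Omega> u) (\<lambda>x. \<mu> * u x)" "L2_eq \<Omega> (dirichlet_op \<Omega> v) (\<lambda>x. \<nu> * v x)"
    using assms by (auto simp: dirichlet_eigenspace_def op_kernel_def op_shift_def L2_eq_diff_zero_iff)
  note L2 = dom[THEN dirichlet_dom_L2] dom[THEN dirichlet_op_L2]
  have "\<mu> * L2_inner \<Omega> u v = L2_inner \<Omega> (dirichlet_op \<Omega> u) v"
    using L2_inner_cong[OF eq(1) _ L2_scale] L2 by (simp add: L2_inner_scale_left)
  also have "\<dots> = L2_inner \<Omega> (dirichlet_op \<Omega> v) u"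
    using dirichlet_op_symmetric[OF dom] by (simp add: L2_inner_commute)
  also have "\<dots> = \<nu> * L2_inner \<Omega> u v"
    using L2_inner_cong[OF eq(2) _ L2_scale] L2 by (simp add: L2_inner_scale_left L2_inner_commute)
  finally show ?thesis using assms(3) by simp
qed

end

section \<open>Expansions in Dirichlet eigenfunctions\<close>

locale dirichlet_basis = finite_open_set \<Omega> for \<Omega> :: "'a::euclidean_space set" +
  fixes lam :: "nat \<Rightarrow> real" and e :: "nat \<Rightarrow> 'a \<Rightarrow> real"
  assumes eigenbasis: "dirichlet_eigenbasis \<Omega> lam e"
begin

lemma e_eigenspace: "e j \<in> dirichlet_eigenspace \<Omega> (lam j)"
  using eigenbasis
  by (auto simp: dirichlet_eigenbasis_def dirichlet_eigenspace_def op_kernel_def op_shift_def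
      L2_eq_diff_zero_iff)

lemma e_L2: "e j \<in> L2_space \<Omega>"
  using eigenbasis by (auto simp: dirichlet_eigenbasis_def intro: dirichlet_dom_L2)

lemma orthonormal: "L2_inner \<Omega> (e j) (e k) = (if j = k then 1 else 0)"
  using eigenbasis by (simp add: dirichlet_eigenbasis_def)

lemma expansion:
  "u \<in> L2_space \<Omega> \<Longrightarrow> L2_tendsto \<Omega> (\<lambda>n x. \<Sum>j<n. L2_inner \<Omega> u (e j) * e j x) u sequentially"
  using eigenbasis by (simp add: dirichlet_eigenbasis_def)

lemma finite_eigenvalue_indices:
  assumes "finite J" shows "finite {j. lam j \<in> J}"
proof -
  have "filterlim lam at_top sequentially" using eigenbasis by (simp add: dirichlet_eigenbasis_def)
  then have "\<forall>\<^sub>F j in sequentially. Max (insert 0 J) < lam j" by (simp add: filterlim_at_top_dense)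
  then obtain N where N: "\<And>j. j \<ge> N \<Longrightarrow> Max (insert 0 J) < lam j"
    by (auto simp: eventually_sequentially)
  have "j < N" if "lam j \<in> J" for j
    using N[of j] Max_ge[of "insert 0 J" "lam j"] that assms by (force simp: not_less)
  then have "{j. lam j \<in> J} \<subseteq> {..<N}" by auto
  then show ?thesis by (rule finite_subset) simp
qed

lemma e_lincomb_L2: "(\<lambda>x. \<Sum>j\<in>A. c j * e j x) \<in> L2_space \<Omega>"
  by (intro L2_sum L2_scale e_L2)

lemma inner_e_lincomb:
  assumes "v \<in> L2_space \<Omega>"
  shows "L2_inner \<Omega> (\<lambda>x. \<Sum>j\<in>A. c j * e j x) v = (\<Sum>j\<in>A. c j * L2_inner \<Omega> v (e j))"
  using assms
  by (simp add: L2_inner_sum_left L2_scale e_L2 L2_inner_scale_left L2_inner_commute[of \<Omega> v])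

lemma coef_e_lincomb:
  assumes "finite A"
  shows "L2_inner \<Omega> (\<lambda>x. \<Sum>j\<in>A. c j * e j x) (e k) = (if k \<in> A then c k else 0)"
  using assms by (simp add: inner_e_lincomb e_L2 orthonormal if_distrib cong: if_cong)

lemma norm_e_lincomb:
  assumes "finite A"
  shows "(L2_norm \<Omega> (\<lambda>x. \<Sum>j\<in>A. c j * e j x))\<^sup>2 = (\<Sum>j\<in>A. (c j)\<^sup>2)"
  unfolding L2_norm_square
  by (subst inner_e_lincomb[OF e_lincomb_L2])
    (auto simp: coef_e_lincomb[OF assms] power2_eq_square intro!: sum.cong)

lemma parseval:
  assumes "u \<in> L2_space \<Omega>" "v \<in> L2_space \<Omega>"
  shows "(\<lambda>j. L2_inner \<Omega> u (e j) * L2_inner \<Omega> v (e j)) sums L2_inner \<Omega> u v"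
  using L2_tendsto_inner[OF expansion[OF assms(1)] assms(2)]
  by (simp add: sums_def inner_e_lincomb[OF assms(2)])

lemma parseval_norm:
  assumes "u \<in> L2_space \<Omega>"
  shows "(\<lambda>j. (L2_inner \<Omega> u (e j))\<^sup>2) sums (L2_norm \<Omega> u)\<^sup>2"
  unfolding L2_norm_square using parseval[OF assms assms] by (simp add: power2_eq_square)

lemma L2_eq_zero_if_coefs:
  assumes "u \<in> L2_space \<Omega>" "\<And>j. L2_inner \<Omega> u (e j) = 0"
  shows "L2_eq \<Omega> u (\<lambda>x. 0)"
proof -
  have "(\<lambda>j. 0) sums L2_inner \<Omega> u u" using parseval[OF assms(1) assms(1)] by (simp add: assms(2))
  then have "L2_inner \<Omega> u u = 0" using sums_unique2 sums_zero by blast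
  then show ?thesis using L2_inner_self_eq_0_iff[OF assms(1)] by simp
qed

lemma L2_eq_if_coefs:
  assumes "u \<in> L2_space \<Omega>" "v \<in> L2_space \<Omega>" "\<And>j. L2_inner \<Omega> u (e j) = L2_inner \<Omega> v (e j)"
  shows "L2_eq \<Omega> u v"
  using L2_eq_zero_if_coefs[OF L2_diff[OF assms(1,2)]] assms
  by (simp add: L2_inner_diff_left e_L2 L2_eq_diff_zero_iff)

text \<open>
  By completeness the series in the definition of \<open>poly_op\<close> has a norm limit on all of \<open>poly_dom\<close>, so
  that the chosen representative has the expected coordinates.
\<close>

lemma square_summable_expansion:
  assumes "summable (\<lambda>j. (c j)\<^sup>2)"
  shows "\<exists>v. L2_tendsto \<Omega> (\<lambda>n x. \<Sum>j<n. c j * e j x) v sequentially"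
proof (rule L2_complete[OF lmeasurable_\<Omega> e_lincomb_L2])
  fix \<epsilon> :: real assume "\<epsilon> > 0"
  then obtain N where N: "\<And>m n. m \<ge> N \<Longrightarrow> norm (\<Sum>j\<in>{m..<n}. (c j)\<^sup>2) < \<epsilon>\<^sup>2"
    using assms unfolding summable_Cauchy by (meson zero_less_power)
  let ?s = "\<lambda>n x. \<Sum>j<n. c j * e j x"
  have *: "L2_norm \<Omega> (\<lambda>x. ?s n x - ?s m x) < \<epsilon>" if "m \<ge> N" "m \<le> n" for m n
  proof -
    have "?s n x - ?s m x = (\<Sum>j\<in>{m..<n}. c j * e j x)" for x
      using sum_diff_nat_ivl[of 0 m n "\<lambda>j. c j * e j x"] that(2) by (simp add: atLeast0LessThan)
    then have "(L2_norm \<Omega> (\<lambda>x. ?s n x - ?s m x))\<^sup>2 < \<epsilon>\<^sup>2"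
      using N[OF that(1), of n] by (simp add: norm_e_lincomb sum_nonneg)
    then show ?thesis by (rule power_less_imp_less_base) (use \<open>\<epsilon> > 0\<close> in simp)
  qed
  have "L2_norm \<Omega> (\<lambda>x. ?s m x - ?s n x) < \<epsilon>" if "m \<ge> N" "n \<ge> N" for m n
  proof (cases "m \<le> n")
    case True
    from *[OF that(1) this] show ?thesis by (subst L2_norm_minus_commute)
  next
    case False
    with that show ?thesis by (intro *) auto
  qed
  then show "\<exists>N. \<forall>m\<ge>N. \<forall>n\<ge>N. L2_norm \<Omega> (\<lambda>x. ?s m x - ?s n x) < \<epsilon>" by blast
qed

lemma poly_op_tendsto:
  assumes "u \<in> poly_dom \<Omega> lam e P"
  shows "L2_tendsto \<Omega> (\<lambda>n x. \<Sum>j<n. poly P (lam j) * L2_inner \<Omega> u (e j) * e j x)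
    (poly_op \<Omega> lam e P u) sequentially"
proof -
  have "summable (\<lambda>j. (poly P (lam j) * L2_inner \<Omega> u (e j))\<^sup>2)"
    using assms by (simp add: poly_dom_def power_mult_distrib)
  from someI_ex[OF square_summable_expansion[OF this]] show ?thesis
    by (simp add: poly_op_def L2_suminf_def)
qed

lemma poly_op_L2: "u \<in> poly_dom \<Omega> lam e P \<Longrightarrow> poly_op \<Omega> lam e P u \<in> L2_space \<Omega>"
  using poly_op_tendsto by (auto simp: L2_tendsto_def)

lemma poly_dom_L2: "u \<in> poly_dom \<Omega> lam e P \<Longrightarrow> u \<in> L2_space \<Omega>"
  by (simp add: poly_dom_def)

lemma coef_poly_op:
  assumes "u \<in> poly_dom \<Omega> lam e P"
  shows "L2_inner \<Omega> (poly_op \<Omega> lam e P u) (e k) = poly P (lam k) * L2_inner \<Omega> u (e k)"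
proof -
  have "\<forall>\<^sub>F n in sequentially. L2_inner \<Omega> (\<lambda>x. \<Sum>j<n. poly P (lam j) * L2_inner \<Omega> u (e j) * e j x) (e k)
      = poly P (lam k) * L2_inner \<Omega> u (e k)"
    using eventually_gt_at_top[of k] by eventually_elim (simp add: coef_e_lincomb)
  from tendsto_unique[OF sequentially_bot L2_tendsto_inner[OF poly_op_tendsto[OF assms] e_L2]
      tendsto_eventually[OF this]]
  show ?thesis .
qed

lemma op_kernel_poly_op_iff:
  "u \<in> op_kernel \<Omega> (poly_dom \<Omega> lam e P) (poly_op \<Omega> lam e P) \<longleftrightarrow>
    u \<in> L2_space \<Omega> \<and> (\<forall>j. poly P (lam j) \<noteq> 0 \<longrightarrow> L2_inner \<Omega> u (e j) = 0)"
proof (intro iffI conjI allI impI)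
  assume u: "u \<in> op_kernel \<Omega> (poly_dom \<Omega> lam e P) (poly_op \<Omega> lam e P)"
  then have dom: "u \<in> poly_dom \<Omega> lam e P" and 0: "L2_eq \<Omega> (poly_op \<Omega> lam e P u) (\<lambda>x. 0)"
    by (auto simp: op_kernel_def)
  show "u \<in> L2_space \<Omega>" using dom by (rule poly_dom_L2)
  fix j assume "poly P (lam j) \<noteq> 0"
  then show "L2_inner \<Omega> u (e j) = 0"
    using coef_poly_op[OF dom, of j] L2_inner_cong[OF 0 poly_op_L2[OF dom] L2_zero e_L2, of j]
    by simp
next
  assume u: "u \<in> L2_space \<Omega> \<and> (\<forall>j. poly P (lam j) \<noteq> 0 \<longrightarrow> L2_inner \<Omega> u (e j) = 0)"
  then have 0: "poly P (lam j) * L2_inner \<Omega> u (e j) = 0" for j by auto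
  then have "(\<lambda>j. \<bar>poly P (lam j)\<bar>\<^sup>2 * \<bar>L2_inner \<Omega> u (e j)\<bar>\<^sup>2) = (\<lambda>j. 0)" by (auto simp: fun_eq_iff)
  then have "summable (\<lambda>j. \<bar>poly P (lam j)\<bar>\<^sup>2 * \<bar>L2_inner \<Omega> u (e j)\<bar>\<^sup>2)"
    using summable_zero by simp
  then have dom: "u \<in> poly_dom \<Omega> lam e P"
    unfolding poly_dom_def using u by blast
  then have "L2_eq \<Omega> (poly_op \<Omega> lam e P u) (\<lambda>x. 0)"
    by (intro L2_eq_zero_if_coefs poly_op_L2) (auto simp: coef_poly_op 0)
  with dom show "u \<in> op_kernel \<Omega> (poly_dom \<Omega> lam e P) (poly_op \<Omega> lam e P)"
    by (simp add: op_kernel_def)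
qed

section \<open>Sums of eigenspaces\<close>

lemma eigenspace_L2: "w \<in> dirichlet_eigenspace \<Omega> \<nu> \<Longrightarrow> w \<in> L2_space \<Omega>"
  by (auto simp: dirichlet_eigenspace_def op_kernel_def intro: dirichlet_dom_L2)

lemma eigenspace_coef:
  "w \<in> dirichlet_eigenspace \<Omega> \<nu> \<Longrightarrow> lam j \<noteq> \<nu> \<Longrightarrow> L2_inner \<Omega> w (e j) = 0"
  using dirichlet_eigenspace_orthogonal[OF _ e_eigenspace, of w \<nu> j] by auto

lemma e_lincomb_eigenspace:
  assumes "finite A" "A \<noteq> {}" "\<And>j. j \<in> A \<Longrightarrow> lam j = \<nu>"
  shows "(\<lambda>x. \<Sum>j\<in>A. c j * e j x) \<in> dirichlet_eigenspace \<Omega> \<nu>"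
  using assms
proof (induction A rule: finite_ne_induct)
  case (singleton j)
  then show ?case
    using dirichlet_eigenspace_lincomb[of "e j" \<nu> "e j" "c j" 0] e_eigenspace[of j] by simp
next
  case (insert j A)
  then show ?case
    using dirichlet_eigenspace_lincomb[of "e j" \<nu> "\<lambda>x. \<Sum>j\<in>A. c j * e j x" "c j" 1] e_eigenspace[of j]
    by simp
qed

text \<open>
  The value of \<open>dirichlet_op\<close> at the zero function is itself a choice of weak derivatives; it is
  determined by writing \<open>0\<close> as a trivial combination of eigenfunctions.
\<close>

lemma zero_eigenspace: "(\<lambda>x. 0) \<in> dirichlet_eigenspace \<Omega> \<nu>"
proof -
  let ?z = "\<lambda>x. 0 * e 0 x + 0 * e 0 x"
  have dom: "e 0 \<in> dirichlet_dom \<Omega>" using eigenbasis by (simp add: dirichlet_eigenbasis_def)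
  then have "L2_eq \<Omega> (dirichlet_op \<Omega> ?z) (\<lambda>x. 0)"
    using dirichlet_op_lincomb[of "e 0" "e 0" 0 0] by (simp add: dirichlet_dom_def)
  moreover have "?z \<in> dirichlet_dom \<Omega>" by (intro dirichlet_dom_lincomb dom)
  ultimately show ?thesis by (simp add: dirichlet_eigenspace_def op_kernel_def op_shift_def)
qed

lemma eigenspace_sum_coef:
  assumes "finite J" "\<And>\<nu>. \<nu> \<in> J \<Longrightarrow> w \<nu> \<in> dirichlet_eigenspace \<Omega> \<nu>"
  shows "L2_inner \<Omega> (\<lambda>x. \<Sum>\<nu>\<in>J. w \<nu> x) (e j)
    = (if lam j \<in> J then L2_inner \<Omega> (w (lam j)) (e j) else 0)"
proof -
  have "L2_inner \<Omega> (\<lambda>x. \<Sum>\<nu>\<in>J. w \<nu> x) (e j) = (\<Sum>\<nu>\<in>J. L2_inner \<Omega> (w \<nu>) (e j))"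
    using assms(2) by (intro L2_inner_sum_left e_L2 eigenspace_L2)
  also have "\<dots> = (\<Sum>\<nu>\<in>J. if \<nu> = lam j then L2_inner \<Omega> (w (lam j)) (e j) else 0)"
  proof (rule sum.cong)
    fix \<nu> assume "\<nu> \<in> J"
    then show "L2_inner \<Omega> (w \<nu>) (e j) = (if \<nu> = lam j then L2_inner \<Omega> (w (lam j)) (e j) else 0)"
      using eigenspace_coef[OF assms(2), of \<nu> j] by auto
  qed simp
  finally show ?thesis using assms(1) by simp
qed

text \<open>
  Orthogonality of eigenspaces removes the coordinates with \<open>\<lambda>\<^sub>j \<notin> J\<close>. Conversely only finitely many
  coordinates have \<open>\<lambda>\<^sub>j \<in> J\<close>, and grouping them by eigenvalue decomposes \<open>u\<close> into eigenfunctions.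
\<close>

lemma eigen_sum_iff:
  assumes "finite J"
  shows "u \<in> eigen_sum \<Omega> J \<longleftrightarrow>
    u \<in> L2_space \<Omega> \<and> (\<forall>j. lam j \<notin> J \<longrightarrow> L2_inner \<Omega> u (e j) = 0)"
proof (intro iffI conjI allI impI)
  assume "u \<in> eigen_sum \<Omega> J"
  then obtain w where u: "u \<in> L2_space \<Omega>"
    and w: "\<And>\<nu>. \<nu> \<in> J \<Longrightarrow> w \<nu> \<in> dirichlet_eigenspace \<Omega> \<nu>"
    and eq: "L2_eq \<Omega> u (\<lambda>x. \<Sum>\<nu>\<in>J. w \<nu> x)" by (auto simp: eigen_sum_def)
  show "u \<in> L2_space \<Omega>" by (rule u)
  fix j assume "lam j \<notin> J"
  then show "L2_inner \<Omega> u (e j) = 0"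
    using L2_inner_cong[OF eq u _ e_L2, of j] L2_sum[of J w \<Omega>] w eigenspace_L2
      eigenspace_sum_coef[OF assms w, of j] by auto
next
  assume u: "u \<in> L2_space \<Omega> \<and> (\<forall>j. lam j \<notin> J \<longrightarrow> L2_inner \<Omega> u (e j) = 0)"
  define w where "w \<nu> x = (\<Sum>j | lam j = \<nu>. L2_inner \<Omega> u (e j) * e j x)" for \<nu> x
  have fin: "finite {j. lam j = \<nu>}" for \<nu> using finite_eigenvalue_indices[of "{\<nu>}"] by simp
  have w: "w \<nu> \<in> dirichlet_eigenspace \<Omega> \<nu>" for \<nu>
  proof (cases "{j. lam j = \<nu>} = {}")
    case True
    then have "w \<nu> = (\<lambda>x. 0)" by (simp add: w_def fun_eq_iff)
    then show ?thesis by (simp add: zero_eigenspace)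
  next
    case False
    show ?thesis unfolding w_def by (rule e_lincomb_eigenspace[OF fin False]) simp
  qed
  have "L2_eq \<Omega> u (\<lambda>x. \<Sum>\<nu>\<in>J. w \<nu> x)"
  proof (rule L2_eq_if_coefs)
    show "(\<lambda>x. \<Sum>\<nu>\<in>J. w \<nu> x) \<in> L2_space \<Omega>" by (intro L2_sum eigenspace_L2[OF w])
    have "L2_inner \<Omega> (w (lam j)) (e j) = L2_inner \<Omega> u (e j)" for j
      unfolding w_def by (simp add: coef_e_lincomb[OF fin])
    then show "L2_inner \<Omega> u (e j) = L2_inner \<Omega> (\<lambda>x. \<Sum>\<nu>\<in>J. w \<nu> x) (e j)" for j
      using eigenspace_sum_coef[OF assms w, of j] u by simp
  qed (use u in simp)
  with u w show "u \<in> eigen_sum \<Omega> J" by (auto simp: eigen_sum_def)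
qed

lemma eigen_sum_is_direct:
  assumes "finite J" shows "eigen_sum_direct \<Omega> J"
  unfolding eigen_sum_direct_def
proof (intro allI impI ballI, elim conjE)
  fix w \<nu>
  assume w: "\<forall>\<nu>\<in>J. w \<nu> \<in> dirichlet_eigenspace \<Omega> \<nu>"
    and 0: "L2_eq \<Omega> (\<lambda>x. \<Sum>\<nu>\<in>J. w \<nu> x) (\<lambda>x. 0)" and \<nu>: "\<nu> \<in> J"
  have L2: "(\<lambda>x. \<Sum>\<nu>\<in>J. w \<nu> x) \<in> L2_space \<Omega>" using w by (intro L2_sum eigenspace_L2) auto
  show "L2_eq \<Omega> (w \<nu>) (\<lambda>x. 0)"
  proof (rule L2_eq_zero_if_coefs)
    show "w \<nu> \<in> L2_space \<Omega>" using w \<nu> eigenspace_L2 by blast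
    show "L2_inner \<Omega> (w \<nu>) (e j) = 0" for j
    proof (cases "lam j = \<nu>")
      case True
      then show ?thesis
        using L2_inner_cong[OF 0 L2 L2_zero e_L2, of j] eigenspace_sum_coef[OF assms, of w j] w \<nu> by simp
    next
      case False
      then show ?thesis using w \<nu> eigenspace_coef by blast
    qed
  qed
qed

text \<open>
  The finite partial expansion over \<open>\<lambda>\<^sub>j \<in> J\<close> shows that an orthogonal projection exists; testing the
  chosen one against the \<open>e\<^sub>j\<close> determines its coordinates.
\<close>

lemma
  assumes "finite J" "u \<in> L2_space \<Omega>"
  shows L2_proj_eigen_sum_L2: "L2_proj \<Omega> (eigen_sum \<Omega> J) u \<in> L2_space \<Omega>"
    and coef_L2_proj_eigen_sum: "L2_inner \<Omega> (L2_proj \<Omega> (eigen_sum \<Omega> J) u) (e j)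
      = (if lam j \<in> J then L2_inner \<Omega> u (e j) else 0)"
proof -
  let ?S = "{j. lam j \<in> J}" and ?E = "L2_proj \<Omega> (eigen_sum \<Omega> J) u"
  let ?w = "\<lambda>x. \<Sum>j\<in>?S. L2_inner \<Omega> u (e j) * e j x"
  have fin: "finite ?S" by (rule finite_eigenvalue_indices[OF assms(1)])
  have coef: "L2_inner \<Omega> ?w (e j) = (if lam j \<in> J then L2_inner \<Omega> u (e j) else 0)" for j
    by (simp add: coef_e_lincomb[OF fin])
  have w: "?w \<in> eigen_sum \<Omega> J"
    using e_lincomb_L2 coef by (simp add: eigen_sum_iff[OF assms(1)])
  have "L2_inner \<Omega> (\<lambda>x. u x - ?w x) v = 0" if "v \<in> eigen_sum \<Omega> J" for v
  proof -
    have v: "v \<in> L2_space \<Omega>" "\<And>j. lam j \<notin> J \<Longrightarrow> L2_inner \<Omega> v (e j) = 0"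
      using that by (auto simp: eigen_sum_iff[OF assms(1)])
    have 0: "L2_inner \<Omega> (\<lambda>x. u x - ?w x) (e j) * L2_inner \<Omega> v (e j) = 0" for j
      using v(2)[of j] by (simp add: L2_inner_diff_left assms(2) e_lincomb_L2 e_L2 coef)
    have "(\<lambda>j. 0) sums L2_inner \<Omega> (\<lambda>x. u x - ?w x) v"
      using parseval[OF L2_diff[OF assms(2) e_lincomb_L2] v(1), of "\<lambda>j. L2_inner \<Omega> u (e j)" ?S]
      by (simp only: 0)
    then show ?thesis using sums_unique2 sums_zero by blast
  qed
  with w have "\<exists>w. w \<in> eigen_sum \<Omega> J \<and> (\<forall>v\<in>eigen_sum \<Omega> J. L2_inner \<Omega> (\<lambda>x. u x - w x) v = 0)"
    by blast
  from someI_ex[OF this] have E: "?E \<in> eigen_sum \<Omega> J"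
    "\<And>v. v \<in> eigen_sum \<Omega> J \<Longrightarrow> L2_inner \<Omega> (\<lambda>x. u x - ?E x) v = 0"
    by (auto simp: L2_proj_def)
  then show L2: "?E \<in> L2_space \<Omega>" by (simp add: eigen_sum_iff[OF assms(1)])
  show "L2_inner \<Omega> ?E (e j) = (if lam j \<in> J then L2_inner \<Omega> u (e j) else 0)"
  proof (cases "lam j \<in> J")
    case True
    then have "e j \<in> eigen_sum \<Omega> J" by (auto simp: eigen_sum_iff[OF assms(1)] e_L2 orthonormal)
    from E(2)[OF this] True show ?thesis by (simp add: L2_inner_diff_left assms(2) L2 e_L2)
  next
    case False
    with E(1) show ?thesis by (simp add: eigen_sum_iff[OF assms(1)])
  qed
qed

section \<open>The projected flow in coordinates\<close>

text \<open>
  Every coordinate \<open>y\<^sub>j = \<langle>u, e\<^sub>j\<rangle>\<close> satisfies \<open>y\<^sub>j' = (m - P(\<lambda>\<^sub>j)) y\<^sub>j\<close> with the common factor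
  \<open>m = \<langle>P(B) u, u\<rangle>\<close>. The quotient of \<open>e\<^bsup>P(\<lambda>\<^sub>j) t\<^esup> y\<^sub>j\<close> by a coordinate with \<open>P(\<lambda>\<^sub>k) = 0\<close> is therefore
  constant, and \<open>m \<ge> 0\<close> keeps the denominator away from \<open>0\<close>, since its square increases. Passing to
  quotients avoids an integral of \<open>m\<close>, which may be unbounded near \<open>t = 0\<close>.
\<close>

lemma flow_coefs:
  assumes flow: "flow_solution \<Omega> lam e P u0 u" and u0: "u0 \<in> L2_space \<Omega>"
    and Pnn: "\<And>j. 0 \<le> poly P (lam j)"
    and k: "poly P (lam k) = 0" "L2_inner \<Omega> u0 (e k) \<noteq> 0"
    and t: "0 \<le> t"
  obtains c where "0 < c"
    "\<And>j. L2_inner \<Omega> (u t) (e j) = c * exp (- poly P (lam j) * t) * L2_inner \<Omega> u0 (e j)"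
proof -
  define y where "y j s = L2_inner \<Omega> (u s) (e j)" for j s
  define m where "m s = L2_inner \<Omega> (poly_op \<Omega> lam e P (u s)) (u s)" for s
  have uL2: "u s \<in> L2_space \<Omega>" if "0 \<le> s" for s
    using flow that by (simp add: flow_solution_def L2_sphere_def)
  have y0: "y j 0 = L2_inner \<Omega> u0 (e j)" for j
    unfolding y_def using flow uL2[of 0] u0
    by (intro L2_inner_cong e_L2) (auto simp: flow_solution_def)
  have cont: "continuous_on {0..} (y j)" for j
    unfolding y_def continuous_on_def
    using flow by (auto simp: flow_solution_def intro!: L2_tendsto_inner e_L2)
  have deriv: "(y j has_real_derivative (m s - poly P (lam j)) * y j s) (at s)" if s: "0 < s" for j s
  proof -
    obtain u' where lim: "L2_tendsto \<Omega> (\<lambda>h x. (u (s + h) x - u s x) / h) u' (at 0)"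
      and eq: "L2_eq \<Omega> u' (\<lambda>x. - tangent_proj \<Omega> (u s) (poly_op \<Omega> lam e P (u s)) x)"
      using flow s by (auto simp: flow_solution_def)
    have dom: "u s \<in> poly_dom \<Omega> lam e P" using flow s by (simp add: flow_solution_def)
    note L2 = poly_op_L2[OF dom] poly_dom_L2[OF dom]
    have t_eq: "(\<lambda>x. - tangent_proj \<Omega> (u s) (poly_op \<Omega> lam e P (u s)) x)
        = (\<lambda>x. m s * u s x - poly_op \<Omega> lam e P (u s) x)"
      by (simp add: tangent_proj_def m_def)
    have "L2_inner \<Omega> u' (e j) = L2_inner \<Omega> (\<lambda>x. m s * u s x - poly_op \<Omega> lam e P (u s) x) (e j)"
      using lim eq unfolding t_eq
      by (intro L2_inner_cong L2_diff L2_scale L2 e_L2) (auto simp: L2_tendsto_def)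
    also have "\<dots> = (m s - poly P (lam j)) * y j s"
      by (simp add: L2_inner_diff_left L2_inner_scale_left L2_scale L2 e_L2 coef_poly_op[OF dom] y_def
          left_diff_distrib)
    finally have "((\<lambda>h. L2_inner \<Omega> (\<lambda>x. (u (s + h) x - u s x) / h) (e j))
        \<longlongrightarrow> (m s - poly P (lam j)) * y j s) (at 0)"
      using L2_tendsto_inner[OF lim e_L2, of j] by simp
    moreover have "\<forall>\<^sub>F h in at 0. L2_inner \<Omega> (\<lambda>x. (u (s + h) x - u s x) / h) (e j) = (y j (s + h) - y j s) / h"
    proof -
      have "\<forall>\<^sub>F h in at 0. - s < h" using s by (intro order_tendstoD(1)[OF tendsto_ident_at]) simp
      then show ?thesis
      proof eventually_elim
        case (elim h)
        then show ?case
          using L2_inner_scale_left[of \<Omega> "1 / h" "\<lambda>x. u (s + h) x - u s x" "e j"] uL2[of "s + h"] uL2[of s] s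
          by (simp add: L2_inner_diff_left e_L2 y_def)
      qed
    qed
    ultimately show ?thesis
      unfolding DERIV_def by (rule Lim_transform_eventually)
  qed
  have m_nonneg: "0 \<le> m s" if s: "0 < s" for s
  proof -
    have dom: "u s \<in> poly_dom \<Omega> lam e P" using flow s by (simp add: flow_solution_def)
    have "(\<lambda>j. poly P (lam j) * (L2_inner \<Omega> (u s) (e j))\<^sup>2) sums m s"
      using parseval[OF poly_op_L2[OF dom] poly_dom_L2[OF dom]]
      by (simp add: m_def coef_poly_op[OF dom] power2_eq_square mult.assoc)
    from sums_le[OF _ sums_zero this] Pnn show ?thesis by simp
  qed
  \<comment> \<open>\<open>(y\<^sub>k\<^sup>2)' = 2 m y\<^sub>k\<^sup>2 \<ge> 0\<close> for \<open>t > 0\<close>, and \<open>y\<^sub>k\<close> is continuous at \<open>0\<close>.\<close>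
  have yk: "y k s \<noteq> 0" if "0 \<le> s" for s
  proof -
    have "(y k 0)\<^sup>2 \<le> (y k s)\<^sup>2"
    proof (rule DERIV_nonneg_imp_increasing_open[OF that])
      fix x assume x: "0 < x" "x < s"
      have "((\<lambda>s. (y k s)\<^sup>2) has_real_derivative 2 * m x * (y k x)\<^sup>2) (at x)"
        using deriv[OF x(1), of k] k(1)
        by (auto intro!: derivative_eq_intros simp: power2_eq_square)
      then show "\<exists>d. ((\<lambda>s. (y k s)\<^sup>2) has_real_derivative d) (at x) \<and> 0 \<le> d"
        using m_nonneg[OF x(1)] by (intro exI[of _ "2 * m x * (y k x)\<^sup>2"]) simp
    qed (intro continuous_intros continuous_on_subset[OF cont], auto)
    with k(2) y0[of k] show ?thesis by auto
  qed
  have const: "y j t * exp (poly P (lam j) * t) / y k t = y j 0 / y k 0" for j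
  proof (cases "t = 0")
    case False
    define r where "r s = y j s * exp (poly P (lam j) * s) / y k s" for s
    have "r t = r 0"
    proof (rule DERIV_isconst_end[of 0 t r])
      show "0 < t" using False t by simp
      show "continuous_on {0..t} r"
        unfolding r_def using yk by (intro continuous_intros continuous_on_subset[OF cont]) auto
      show "(r has_real_derivative 0) (at x)" if "0 < x" "x < t" for x
        unfolding r_def using deriv[OF that(1), of j] deriv[OF that(1), of k] yk[of x] k(1) that
        by (auto intro!: derivative_eq_intros simp: algebra_simps)
    qed
    then show ?thesis by (simp add: r_def)
  qed simp
  have pos: "0 < y k t / y k 0"
  proof (rule ccontr)
    assume neg: "\<not> 0 < y k t / y k 0"
    have "\<exists>x. 0 \<le> x \<and> x \<le> t \<and> y k x / y k 0 = 0"
      using neg t yk[of 0]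
      by (intro IVT2') (auto intro!: continuous_intros continuous_on_subset[OF cont])
    then show False using yk yk[of 0] by auto
  qed
  show thesis
  proof (rule that[OF pos])
    fix j
    have "y j t = (y j 0 / y k 0) * y k t / exp (poly P (lam j) * t)"
      unfolding const[of j, symmetric] using yk[OF t] by simp
    then show "L2_inner \<Omega> (u t) (e j) = y k t / y k 0 * exp (- poly P (lam j) * t) * L2_inner \<Omega> u0 (e j)"
      by (simp add: y_def[of j t, symmetric] y0[symmetric] exp_minus field_simps)
  qed
qed

text \<open>
  With \<open>\<rho> = \<parallel>E\<parallel>\<close> and \<open>c\<close> the factor of \<open>flow_coefs\<close>, the square of the distance is \<open>2 - 2 c \<rho>\<close>. As
  \<open>c \<rho> \<le> 1\<close>, it is at most \<open>2 (1 - c\<^sup>2 \<rho>\<^sup>2)\<close>, where \<open>\<parallel>u(t)\<parallel> = 1\<close> identifies \<open>1 - c\<^sup>2 \<rho>\<^sup>2\<close> as the mass of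
  \<open>u(t)\<close> outside the limiting subspace; that mass is at most \<open>c\<^sup>2 e\<^bsup>-2 \<delta> t\<^esup> \<le> \<rho>\<^sup>-\<^sup>2 e\<^bsup>-2 \<delta> t\<^esup>\<close>.
\<close>

lemma flow_convergence:
  fixes P J u0
  defines "E \<equiv> L2_proj \<Omega> (eigen_sum \<Omega> J) u0"
  assumes flow: "flow_solution \<Omega> lam e P u0 u" and u0: "u0 \<in> L2_sphere \<Omega>" and J: "finite J"
    and P0: "\<And>j. lam j \<in> J \<Longrightarrow> poly P (lam j) = 0"
    and Pgap: "\<And>j. lam j \<notin> J \<Longrightarrow> \<delta> \<le> poly P (lam j)" and \<delta>: "0 < \<delta>"
    and E: "\<not> L2_eq \<Omega> E (\<lambda>x. 0)"
    and t: "0 \<le> t"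
  shows "L2_norm \<Omega> (\<lambda>x. u t x - E x / L2_norm \<Omega> E) \<le> 2 / L2_norm \<Omega> E * exp (- \<delta> * t)"
proof -
  let ?P = "\<lambda>j. poly P (lam j)"
  define \<rho> where "\<rho> = L2_norm \<Omega> E"
  have u0L2: "u0 \<in> L2_space \<Omega>" and u0n: "L2_norm \<Omega> u0 = 1" using u0 by (auto simp: L2_sphere_def)
  note EL2 = L2_proj_eigen_sum_L2[OF J u0L2, folded E_def]
    and coefE = coef_L2_proj_eigen_sum[OF J u0L2, folded E_def]
  have \<rho>: "0 < \<rho>" using E L2_norm_eq_0_iff[OF EL2] L2_norm_nonneg[of \<Omega> E] by (simp add: \<rho>_def less_le)
  obtain k where k: "L2_inner \<Omega> E (e k) \<noteq> 0" using E L2_eq_zero_if_coefs[OF EL2] by blast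
  then have kJ: "lam k \<in> J" "L2_inner \<Omega> u0 (e k) \<noteq> 0" by (auto simp: coefE split: if_splits)
  have Pnn: "0 \<le> ?P j" for j using P0[of j] Pgap[of j] \<delta> by (cases "lam j \<in> J") auto
  obtain c where c: "0 < c"
    and coef: "\<And>j. L2_inner \<Omega> (u t) (e j) = c * exp (- ?P j * t) * L2_inner \<Omega> u0 (e j)"
    using flow_coefs[OF flow u0L2 Pnn P0[OF kJ(1)] kJ(2) t] by blast
  have utL2: "u t \<in> L2_space \<Omega>" and utn: "L2_norm \<Omega> (u t) = 1"
    using flow t by (auto simp: flow_solution_def L2_sphere_def)
  have E2: "(\<lambda>j. c\<^sup>2 * (L2_inner \<Omega> E (e j))\<^sup>2) sums (c\<^sup>2 * \<rho>\<^sup>2)"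
    using sums_mult[OF parseval_norm[OF EL2]] by (simp add: \<rho>_def)
  have ut2: "(\<lambda>j. (L2_inner \<Omega> (u t) (e j))\<^sup>2) sums 1"
    using parseval_norm[OF utL2] by (simp add: utn)
  have "c\<^sup>2 * \<rho>\<^sup>2 \<le> 1"
    by (rule sums_le[OF _ E2 ut2]) (auto simp: coefE coef P0 power_mult_distrib)
  then have c\<rho>: "c * \<rho> \<le> 1" by (simp add: power_mult_distrib[symmetric] power_le_one_iff c \<rho> abs_square_le_1)
  have upper: "1 \<le> c\<^sup>2 * \<rho>\<^sup>2 + c\<^sup>2 * (exp (- \<delta> * t))\<^sup>2 * 1"
  proof (rule sums_le[OF _ ut2])
    have "(\<lambda>j. c\<^sup>2 * (exp (- \<delta> * t))\<^sup>2 * (L2_inner \<Omega> u0 (e j))\<^sup>2) sums (c\<^sup>2 * (exp (- \<delta> * t))\<^sup>2 * 1)"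
      using sums_mult[OF parseval_norm[OF u0L2]] by (simp add: u0n)
    then show "(\<lambda>j. c\<^sup>2 * (L2_inner \<Omega> E (e j))\<^sup>2 + c\<^sup>2 * (exp (- \<delta> * t))\<^sup>2 * (L2_inner \<Omega> u0 (e j))\<^sup>2)
        sums (c\<^sup>2 * \<rho>\<^sup>2 + c\<^sup>2 * (exp (- \<delta> * t))\<^sup>2 * 1)" by (rule sums_add[OF E2])
    fix j
    show "(L2_inner \<Omega> (u t) (e j))\<^sup>2
        \<le> c\<^sup>2 * (L2_inner \<Omega> E (e j))\<^sup>2 + c\<^sup>2 * (exp (- \<delta> * t))\<^sup>2 * (L2_inner \<Omega> u0 (e j))\<^sup>2"
    proof (cases "lam j \<in> J")
      case True
      then show ?thesis by (simp add: coefE coef P0 power_mult_distrib)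
    next
      case False
      have "exp (- ?P j * t) \<le> exp (- \<delta> * t)" using Pgap[OF False] t by (simp add: mult_right_mono)
      then have "(exp (- ?P j * t))\<^sup>2 \<le> (exp (- \<delta> * t))\<^sup>2" by (intro power_mono) auto
      then have "c\<^sup>2 * (exp (- ?P j * t))\<^sup>2 * (L2_inner \<Omega> u0 (e j))\<^sup>2
          \<le> c\<^sup>2 * (exp (- \<delta> * t))\<^sup>2 * (L2_inner \<Omega> u0 (e j))\<^sup>2"
        by (intro mult_right_mono mult_left_mono) auto
      with False show ?thesis by (simp add: coefE coef power_mult_distrib)
    qed
  qed
  have inner: "L2_inner \<Omega> (u t) E = c * \<rho>\<^sup>2"
  proof (rule sums_unique2)
    show "(\<lambda>j. L2_inner \<Omega> (u t) (e j) * L2_inner \<Omega> E (e j)) sums L2_inner \<Omega> (u t) E"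
      by (rule parseval[OF utL2 EL2])
    have "(\<lambda>j. c * (L2_inner \<Omega> E (e j))\<^sup>2) sums (c * \<rho>\<^sup>2)"
      using sums_mult[OF parseval_norm[OF EL2]] by (simp add: \<rho>_def)
    moreover have "c * (L2_inner \<Omega> E (e j))\<^sup>2 = L2_inner \<Omega> (u t) (e j) * L2_inner \<Omega> E (e j)" for j
      by (simp add: coefE coef P0 power2_eq_square)
    ultimately show "(\<lambda>j. L2_inner \<Omega> (u t) (e j) * L2_inner \<Omega> E (e j)) sums (c * \<rho>\<^sup>2)" by simp
  qed
  have "(L2_norm \<Omega> (\<lambda>x. u t x - (1 / \<rho>) * E x))\<^sup>2 = 2 - 2 * (c * \<rho>)"
    unfolding L2_norm_diff_square[OF utL2 L2_scale[OF EL2]] L2_norm_scale L2_inner_scale_right inner utn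
    using \<rho> by (simp add: \<rho>_def[symmetric] power2_eq_square field_simps)
  also have "\<dots> \<le> 2 * (1 - (c * \<rho>)\<^sup>2)"
  proof -
    have "(c * \<rho>) * (c * \<rho>) \<le> c * \<rho> * 1" using c\<rho> c \<rho> by (intro mult_left_mono) auto
    then show ?thesis by (simp add: power2_eq_square)
  qed
  also have "\<dots> \<le> 2 * (c\<^sup>2 * (exp (- \<delta> * t))\<^sup>2)" using upper by (simp add: power_mult_distrib)
  also have "\<dots> \<le> 2 * ((1 / \<rho>)\<^sup>2 * (exp (- \<delta> * t))\<^sup>2)"
  proof -
    have "c \<le> 1 / \<rho>" using c\<rho> \<rho> by (simp add: field_simps)
    then have "c\<^sup>2 \<le> (1 / \<rho>)\<^sup>2" using c by (intro power_mono) auto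
    then show ?thesis by (intro mult_left_mono mult_right_mono) auto
  qed
  also have "\<dots> \<le> (2 / \<rho> * exp (- \<delta> * t))\<^sup>2"
    by (simp add: power_mult_distrib power_divide mult_right_mono divide_right_mono)
  finally have "L2_norm \<Omega> (\<lambda>x. u t x - (1 / \<rho>) * E x) \<le> 2 / \<rho> * exp (- \<delta> * t)"
    by (rule power2_le_imp_le) (use \<rho> in simp)
  then show ?thesis by (simp add: \<rho>_def)
qed

end

section \<open>The selecting polynomial\<close>

lemma poly_P_sel: "poly (P_sel J) s = (\<Prod>\<nu>\<in>J. (s - \<nu>)\<^sup>2)"
  by (simp add: P_sel_def poly_prod poly_power)

lemma lead_coeff_P_sel: "lead_coeff (P_sel J) = 1"
  unfolding P_sel_def
  by (induction J rule: infinite_finite_induct) (simp_all add: lead_coeff_mult lead_coeff_power)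

lemma poly_P_sel_nonneg: "0 \<le> poly (P_sel J) s"
  by (simp add: poly_P_sel prod_nonneg)

lemma poly_P_sel_eq_0_iff: "finite J \<Longrightarrow> poly (P_sel J) s = 0 \<longleftrightarrow> s \<in> J"
  by (auto simp: poly_P_sel)

text \<open>
  Above \<open>max J + 1\<close> every factor of the polynomial is at least \<open>1\<close>, and only finitely many indices
  have a smaller eigenvalue.
\<close>

lemma (in dirichlet_basis) P_sel_gap:
  assumes "finite J"
  obtains \<delta> where "0 < \<delta>" "\<And>j. lam j \<notin> J \<Longrightarrow> \<delta> \<le> poly (P_sel J) (lam j)"
proof -
  \<comment> \<open>The element \<open>0\<close> only serves to have a maximum for empty \<open>J\<close>.\<close>
  define M where "M = Max (insert 0 J) + 1"
  have big: "1 \<le> poly (P_sel J) s" if "M \<le> s" for s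
  proof -
    have "1 \<le> (s - \<nu>)\<^sup>2" if "\<nu> \<in> J" for \<nu>
    proof -
      have "\<nu> \<le> Max (insert 0 J)" using assms that by simp
      then have "1 \<le> s - \<nu>" using \<open>M \<le> s\<close> by (simp add: M_def)
      then show ?thesis by (simp add: one_le_power)
    qed
    then show ?thesis by (simp add: poly_P_sel prod_ge_1)
  qed
  have "filterlim lam at_top sequentially" using eigenbasis by (simp add: dirichlet_eigenbasis_def)
  then have "\<forall>\<^sub>F j in sequentially. M \<le> lam j" by (simp add: filterlim_at_top)
  then obtain N where N: "\<And>j. j \<ge> N \<Longrightarrow> M \<le> lam j" by (auto simp: eventually_sequentially)
  define A where "A = insert 1 ((\<lambda>j. poly (P_sel J) (lam j)) ` {j. j < N \<and> lam j \<notin> J})"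
  have fin: "finite A" "A \<noteq> {}" by (auto simp: A_def)
  show ?thesis
  proof (rule that[of "Min A"])
    have "0 < poly (P_sel J) s" if "s \<notin> J" for s
      using that poly_P_sel_nonneg[of J s] poly_P_sel_eq_0_iff[OF assms, of s] by linarith
    then have "0 < a" if "a \<in> A" for a using that by (auto simp: A_def)
    then show "0 < Min A" using fin by simp
    fix j assume j: "lam j \<notin> J"
    show "Min A \<le> poly (P_sel J) (lam j)"
    proof (cases "j < N")
      case True
      with j have "poly (P_sel J) (lam j) \<in> A" by (auto simp: A_def)
      then show ?thesis using fin by simp
    next
      case False
      then have "1 \<le> poly (P_sel J) (lam j)" using big N by simp
      moreover have "Min A \<le> 1" using fin by (simp add: A_def)
      ultimately show ?thesis by simp
    qed
  qed
qed

theorem theorem4p1: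
  fixes \<Omega> :: "'a::euclidean_space set"
    and lam :: "nat \<Rightarrow> real"
    and e :: "nat \<Rightarrow> 'a \<Rightarrow> real"
    and J :: "real set"
  assumes "smooth_bounded_domain \<Omega>"
    and "dirichlet_eigenbasis \<Omega> lam e"
    and "finite J" and "J \<noteq> {}" and "J \<subseteq> dirichlet_spectrum \<Omega>"
  shows "(\<forall>s. poly (P_sel J) s = (\<Prod>\<nu>\<in>J. (s - \<nu>)\<^sup>2)) \<and> lead_coeff (P_sel J) > 0 \<and>
     ((\<exists>\<mu>\<in>dirichlet_spectrum \<Omega>. poly (P_sel J) \<mu> = 0) \<and>
      (\<forall>\<mu>\<in>dirichlet_spectrum \<Omega>. 0 \<le> poly (P_sel J) \<mu>)) \<and>
     minimizing_subspace \<Omega> lam e (P_sel J)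
       = op_kernel \<Omega> (poly_dom \<Omega> lam e (P_sel J)) (poly_op \<Omega> lam e (P_sel J)) \<and>
     op_kernel \<Omega> (poly_dom \<Omega> lam e (P_sel J)) (poly_op \<Omega> lam e (P_sel J)) = eigen_sum \<Omega> J \<and>
     eigen_sum_direct \<Omega> J \<and>
     (\<forall>u0 u. u0 \<in> L2_sphere \<Omega> \<and>
        \<not> L2_eq \<Omega> (L2_proj \<Omega> (eigen_sum \<Omega> J) u0) (\<lambda>x. 0) \<and>
        flow_solution \<Omega> lam e (P_sel J) u0 u \<longrightarrow>
        (let E = L2_proj \<Omega> (eigen_sum \<Omega> J) u0;
             u_inf = (\<lambda>x. E x / L2_norm \<Omega> E)
         in L2_tendsto \<Omega> u u_inf at_top \<and>
            (\<not> L2_eq \<Omega> (\<lambda>x. u0 x - E x) (\<lambda>x. 0) \<longrightarrow>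
               (\<exists>C>0. \<exists>\<delta>>0. \<forall>t\<ge>0. L2_norm \<Omega> (\<lambda>x. u t x - u_inf x) \<le> C * exp (- \<delta> * t)))))"
proof -
  interpret dirichlet_basis \<Omega> lam e
    using assms(1,2)
    by unfold_locales (auto simp: smooth_bounded_domain_def intro: lmeasurable_open)
  let ?P = "P_sel J" and ?\<Lambda> = "dirichlet_spectrum \<Omega>"
  have zero: "\<exists>\<mu>\<in>?\<Lambda>. poly ?P \<mu> = 0"
    using assms(3-5) poly_P_sel_eq_0_iff[OF assms(3)] by blast
  have "(INF \<mu>\<in>?\<Lambda>. poly ?P \<mu>) = 0"
  proof (rule antisym)
    have "bdd_below (poly ?P ` ?\<Lambda>)" by (rule bdd_belowI[of _ 0]) (auto simp: poly_P_sel_nonneg)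
    with zero show "(INF \<mu>\<in>?\<Lambda>. poly ?P \<mu>) \<le> 0" by (metis cINF_lower)
    show "0 \<le> (INF \<mu>\<in>?\<Lambda>. poly ?P \<mu>)"
      using zero by (intro cINF_greatest) (auto simp: poly_P_sel_nonneg)
  qed
  then have min: "minimizing_subspace \<Omega> lam e ?P
      = op_kernel \<Omega> (poly_dom \<Omega> lam e ?P) (poly_op \<Omega> lam e ?P)"
    by (simp add: minimizing_subspace_def op_shift_def)
  have ker: "op_kernel \<Omega> (poly_dom \<Omega> lam e ?P) (poly_op \<Omega> lam e ?P) = eigen_sum \<Omega> J"
    by (intro set_eqI)
      (simp add: op_kernel_poly_op_iff eigen_sum_iff[OF assms(3)] poly_P_sel_eq_0_iff[OF assms(3)])
  obtain \<delta> where \<delta>: "0 < \<delta>" and gap: "\<And>j. lam j \<notin> J \<Longrightarrow> \<delta> \<le> poly ?P (lam j)"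
    using P_sel_gap[OF assms(3)] by blast
  have conv: "L2_tendsto \<Omega> u (\<lambda>x. E x / L2_norm \<Omega> E) at_top \<and>
      (\<exists>C>0. \<exists>\<delta>>0. \<forall>t\<ge>0. L2_norm \<Omega> (\<lambda>x. u t x - E x / L2_norm \<Omega> E) \<le> C * exp (- \<delta> * t))"
    if u0: "u0 \<in> L2_sphere \<Omega>" and E_def: "E = L2_proj \<Omega> (eigen_sum \<Omega> J) u0"
      and E0: "\<not> L2_eq \<Omega> E (\<lambda>x. 0)" and flow: "flow_solution \<Omega> lam e ?P u0 u" for u0 u E
  proof
    have EL2: "E \<in> L2_space \<Omega>"
      unfolding E_def using u0 by (intro L2_proj_eigen_sum_L2 assms(3)) (simp add: L2_sphere_def)
    have \<rho>: "0 < L2_norm \<Omega> E"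
      using E0 L2_norm_eq_0_iff[OF EL2] L2_norm_nonneg[of \<Omega> E] by (simp add: less_le)
    have bound: "L2_norm \<Omega> (\<lambda>x. u t x - E x / L2_norm \<Omega> E) \<le> 2 / L2_norm \<Omega> E * exp (- \<delta> * t)"
      if "0 \<le> t" for t
      using flow_convergence[OF flow u0 assms(3) _ gap \<delta> _ that] E0 poly_P_sel_eq_0_iff[OF assms(3)]
      by (simp add: E_def)
    have "((\<lambda>t. L2_norm \<Omega> (\<lambda>x. u t x - E x / L2_norm \<Omega> E)) \<longlongrightarrow> 0) at_top"
    proof (rule tendsto_sandwich[OF _ _ tendsto_const])
      show "\<forall>\<^sub>F t in at_top. L2_norm \<Omega> (\<lambda>x. u t x - E x / L2_norm \<Omega> E)
          \<le> 2 / L2_norm \<Omega> E * exp (- \<delta> * t)"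
        using eventually_ge_at_top[of 0] by eventually_elim (rule bound)
      have "filterlim (\<lambda>t. - \<delta> * t) at_bot at_top"
        using \<delta> by (intro filterlim_tendsto_neg_mult_at_bot[OF tendsto_const _ filterlim_ident]) simp
      then have "((\<lambda>t. exp (- \<delta> * t)) \<longlongrightarrow> 0) at_top"
        by (rule filterlim_compose[OF exp_at_bot])
      then show "((\<lambda>t. 2 / L2_norm \<Omega> E * exp (- \<delta> * t)) \<longlongrightarrow> 0) at_top"
        by (rule tendsto_mult_right_zero)
    qed simp
    moreover have "(\<lambda>x. E x / L2_norm \<Omega> E) \<in> L2_space \<Omega>"
      using L2_scale[OF EL2, of "1 / L2_norm \<Omega> E"] by simp
    moreover have "\<forall>\<^sub>F t in at_top. u t \<in> L2_space \<Omega>"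
      using eventually_ge_at_top[of 0]
    proof eventually_elim
      case (elim t)
      with flow show ?case by (simp add: flow_solution_def L2_sphere_def)
    qed
    ultimately show "L2_tendsto \<Omega> u (\<lambda>x. E x / L2_norm \<Omega> E) at_top" by (simp add: L2_tendsto_def)
    show "\<exists>C>0. \<exists>\<delta>>0. \<forall>t\<ge>0. L2_norm \<Omega> (\<lambda>x. u t x - E x / L2_norm \<Omega> E) \<le> C * exp (- \<delta> * t)"
      using bound \<rho> \<delta> by (intro exI[of _ "2 / L2_norm \<Omega> E"] exI[of _ \<delta>] conjI) auto
  qed
  show ?thesis
    using zero min ker eigen_sum_is_direct[OF assms(3)] conv
    by (auto simp: poly_P_sel lead_coeff_P_sel poly_P_sel_nonneg[unfolded poly_P_sel] Let_def)
qed

end
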